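(* Let $n\ge 1$ and let $L$ be the sub-Laplacian on $\mathbb{S}^{4n+3}$ associated to the quaternionic Hopf fibration $\mathbf{SU}(2)\to\mathbb{S}^{4n+3}\to\mathbb{HP}^n$. The cylindric part of $L$ is given in the coordinates $(r,\eta)$ by $$\tilde{L}=\frac{\partial^2}{\partial r^2}+\big((4n-1)\cot r-3\tan r\big)\frac{\partial}{\partial r}+\tan^2 r\left(\frac{\partial^2}{\partial \eta^2}+2\cot \eta\,\frac{\partial}{\partial \eta}\right).$$ That is, for every $f\in\mathcal{D}$, viewed as a function of $(r,\eta)$ through $\rho=\tan r$, one has $L(f\circ\psi)=(\tilde{L}f)\circ\psi$ at the points where $0<r<\pi/2$ and $0<\eta<\pi$.
   Context: $\mathbb{H}$ denotes the quaternions with imaginary units $I,J,K$ and the usual norm, and $\mathbb{S}^{4n+3}=\{q=(q_1,\dots,q_{n+1})\in\mathbb{H}^{n+1}:\|q\|=1\}$ carries its standard round metric with Laplace–Beltrami operator $\Delta$. The group $\mathbf{SU}(2)$, identified with the unit quaternions, acts isometrically on $\mathbb{S}^{4n+3}$ by $g\cdot(q_1,\dots,q_{n+1})=(gq_1,\dots,gq_{n+1})$, with quotient $\mathbb{HP}^n$ (metric such that the projection is a Riemannian submersion). The sub-Laplacian $L$ is the lift (horizontal Laplacian) of the Laplace–Beltrami operator of $\mathbb{HP}^n$; explicitly $L=\Delta-T_1^2-T_2^2-T_3^2$, where $T_1f(q)=\frac{d}{d\theta}\big|_{\theta=0}f(e^{I\theta}q)$, $T_2f(q)=\frac{d}{d\theta}\big|_{\theta=0}f(e^{J\theta}q)$,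 $T_3f(q)=\frac{d}{d\theta}\big|_{\theta=0}f(e^{K\theta}q)$. On $\{q_{n+1}\ne0\}$ put $w_j=q_jq_{n+1}^{-1}$, $\rho=\big(\sum_{j=1}^n|w_j|^2\big)^{1/2}$, and let $\eta\in[0,\pi]$ be the Riemannian distance from the identity to $q_{n+1}/|q_{n+1}|$ in $\mathbf{SU}(2)\cong\mathbb{S}^3$ (unit round metric). Set $\psi(q)=(\rho,\eta)$ and $\rho=\tan r$ with $r\in[0,\pi/2)$; thus $|q_{n+1}|=\cos r$ and $\mathrm{Re}(q_{n+1})=\cos r\cos\eta$. $\mathcal{D}$ is the space of smooth compactly supported functions on $\mathbb{R}_{\ge0}\times\mathbb{R}/2\pi\mathbb{Z}$ (in the variables $(\rho,\eta)$). The cylindric part of $L$ is the operator $\tilde{L}$ on $\mathcal{D}$ defined by $L(f\circ\psi)=(\tilde{L}f)\circ\psi$ for all $f\in\mathcal{D}$. *)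

theory Defs
  imports "HOL-Analysis.Analysis"
begin

section \<open>Quaternions\<close>

datatype quat = Quat (qRe: real) (qI: real) (qJ: real) (qK: real)

lemma quat_eq_iff: "x = y \<longleftrightarrow> qRe x = qRe y \<and> qI x = qI y \<and> qJ x = qJ y \<and> qK x = qK y"
  by (auto intro: quat.expand)

instantiation quat :: real_vector
begin

definition "0 = Quat 0 0 0 0"
definition "x + y = Quat (qRe x + qRe y) (qI x + qI y) (qJ x + qJ y) (qK x + qK y)"
definition "x - y = Quat (qRe x - qRe y) (qI x - qI y) (qJ x - qJ y) (qK x - qK y)"
definition "- x = Quat (- qRe x) (- qI x) (- qJ x) (- qK x)"
definition "c *\<^sub>R x = Quat (c * qRe x) (c * qI x) (c * qJ x) (c * qK x)"

instance
  by standard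
    (simp_all add: quat_eq_iff zero_quat_def plus_quat_def minus_quat_def uminus_quat_def
      scaleR_quat_def algebra_simps)

end

lemma quat_components [simp]:
  "qRe 0 = 0" "qI 0 = 0" "qJ 0 = 0" "qK 0 = 0"
  "qRe (x + y) = qRe x + qRe y" "qI (x + y) = qI x + qI y"
  "qJ (x + y) = qJ x + qJ y" "qK (x + y) = qK x + qK y"
  "qRe (x - y) = qRe x - qRe y" "qI (x - y) = qI x - qI y"
  "qJ (x - y) = qJ x - qJ y" "qK (x - y) = qK x - qK y"
  "qRe (- x) = - qRe x" "qI (- x) = - qI x" "qJ (- x) = - qJ x" "qK (- x) = - qK x"
  "qRe (c *\<^sub>R x) = c * qRe x" "qI (c *\<^sub>R x) = c * qI x"
  "qJ (c *\<^sub>R x) = c * qJ x" "qK (c *\<^sub>R x) = c * qK x"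
  by (simp_all add: zero_quat_def plus_quat_def minus_quat_def uminus_quat_def scaleR_quat_def)

instantiation quat :: euclidean_space
begin

definition "inner x y = qRe x * qRe y + qI x * qI y + qJ x * qJ y + qK x * qK y"
  for x y :: quat
definition "norm x = sqrt (inner x x)" for x :: quat
definition "sgn x = x /\<^sub>R norm x" for x :: quat
definition "dist x y = norm (x - y)" for x y :: quat
definition "(uniformity :: (quat \<times> quat) filter) =
  (INF e\<in>{0 <..}. principal {(x, y). dist x y < e})"
definition "open (U :: quat set) \<longleftrightarrow>
  (\<forall>x\<in>U. eventually (\<lambda>(x', y). x' = x \<longrightarrow> y \<in> U) uniformity)"
definition "Basis = {Quat 1 0 0 0, Quat 0 1 0 0, Quat 0 0 1 0, Quat 0 0 0 1}"

instance
proof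
  fix x y z :: quat and c :: real
  show "inner x x = 0 \<longleftrightarrow> x = 0"
  proof
    assume "inner x x = 0"
    then have "(qRe x)\<^sup>2 + (qI x)\<^sup>2 + (qJ x)\<^sup>2 + (qK x)\<^sup>2 = 0"
      by (simp add: inner_quat_def power2_eq_square)
    then show "x = 0"
      by (simp add: quat_eq_iff add_nonneg_eq_0_iff)
  qed (simp add: inner_quat_def)
  show "(\<forall>u\<in>Basis. inner x u = 0) \<longleftrightarrow> x = 0"
    by (simp add: Basis_quat_def inner_quat_def) (auto simp: quat_eq_iff)
qed (auto simp: inner_quat_def norm_quat_def sgn_quat_def dist_quat_def uniformity_quat_def
      open_quat_def Basis_quat_def algebra_simps quat_eq_iff)

end

text \<open>Hamilton's product, \<open>I\<^sup>2 = J\<^sup>2 = K\<^sup>2 = I J K = -1\<close>.\<close>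

instantiation quat :: real_normed_div_algebra
begin

definition "1 = Quat 1 0 0 0"
definition "x * y = Quat
  (qRe x * qRe y - qI x * qI y - qJ x * qJ y - qK x * qK y)
  (qRe x * qI y + qI x * qRe y + qJ x * qK y - qK x * qJ y)
  (qRe x * qJ y - qI x * qK y + qJ x * qRe y + qK x * qI y)
  (qRe x * qK y + qI x * qJ y - qJ x * qI y + qK x * qRe y)"
definition "inverse x = Quat (qRe x) (- qI x) (- qJ x) (- qK x) /\<^sub>R (norm x)\<^sup>2" for x :: quat
definition "x div y = x * inverse y" for x y :: quat

instance
proof
  fix x y :: quat
  have sq: "(norm z)\<^sup>2 = (qRe z)\<^sup>2 + (qI z)\<^sup>2 + (qJ z)\<^sup>2 + (qK z)\<^sup>2" for z :: quat
    unfolding power2_norm_eq_inner by (simp add: inner_quat_def power2_eq_square)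
  have "(norm (x * y))\<^sup>2 = (norm x * norm y)\<^sup>2"
    by (simp add: power_mult_distrib sq times_quat_def) algebra
  then show "norm (x * y) = norm x * norm y"
    by simp
  show "inverse x * x = 1" if "x \<noteq> 0"
  proof -
    have "(norm x)\<^sup>2 \<noteq> 0" using that by simp
    then show ?thesis
      by (simp add: quat_eq_iff inverse_quat_def one_quat_def times_quat_def field_simps)
        (simp add: sq [unfolded power2_eq_square] power2_eq_square algebra_simps)
  qed
  show "x * inverse x = 1" if "x \<noteq> 0"
  proof -
    have "(norm x)\<^sup>2 \<noteq> 0" using that by simp
    then show ?thesis
      by (simp add: quat_eq_iff inverse_quat_def one_quat_def times_quat_def field_simps)
        (simp add: sq [unfolded power2_eq_square] power2_eq_square algebra_simps)
  qed
qed (auto simp: quat_eq_iff one_quat_def times_quat_def inverse_quat_def divide_quat_def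
    algebra_simps)

end

definition quatI :: quat where "quatI = Quat 0 1 0 0"
definition quatJ :: quat where "quatJ = Quat 0 0 1 0"
definition quatK :: quat where "quatK = Quat 0 0 0 1"

lemma quat_units:
  "quatI * quatI = - 1" "quatJ * quatJ = - 1" "quatK * quatK = - 1"
  "quatI * quatJ = quatK" "quatJ * quatK = quatI" "quatK * quatI = quatJ"
  by (simp_all add: quatI_def quatJ_def quatK_def quat_eq_iff times_quat_def one_quat_def)


section \<open>Round spheres\<close>

text \<open>
  The unit sphere of a Euclidean space \<open>'a\<close> is \<open>sphere 0 1\<close>, with the induced metric.  Functions
  and vector fields on it are represented by functions on \<open>'a\<close>; all notions below depend only on
  their values on the sphere.

  The curve \<open>t \<mapsto> sgn (p + t u) = (p + t u) / \<parallel>p + t u\<parallel>\<close> lies in the sphere and, for \<open>u\<close> tangent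
  at \<open>p\<close>, starts at \<open>p\<close> with velocity \<open>u\<close>; so \<open>sphere_deriv X p u\<close> is the directional derivative
  of \<open>X\<close> at \<open>p\<close> along the tangent vector \<open>u\<close>.
\<close>

definition sphere_deriv :: "('a::euclidean_space \<Rightarrow> 'b::real_normed_vector) \<Rightarrow> 'a \<Rightarrow> 'a \<Rightarrow> 'b" where
  "sphere_deriv X p u = vector_derivative (\<lambda>t. X (sgn (p + t *\<^sub>R u))) (at 0)"

definition sphere_tangent :: "'a::euclidean_space \<Rightarrow> 'a set" where
  "sphere_tangent p = {u. u \<bullet> p = 0}"

definition tangent_proj :: "'a::euclidean_space \<Rightarrow> 'a \<Rightarrow> 'a" where
  "tangent_proj p v = v - (v \<bullet> p) *\<^sub>R p"

definition sphere_grad :: "('a::euclidean_space \<Rightarrow> real) \<Rightarrow> 'a \<Rightarrow> 'a" where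
  "sphere_grad f p =
     (THE v. v \<in> sphere_tangent p \<and> (\<forall>u\<in>sphere_tangent p. v \<bullet> u = sphere_deriv f p u))"

text \<open>The Levi-Civita connection of a submanifold of a Euclidean space is the tangential part of
  the ambient derivative.\<close>

definition sphere_connection :: "('a::euclidean_space \<Rightarrow> 'a) \<Rightarrow> 'a \<Rightarrow> 'a \<Rightarrow> 'a" where
  "sphere_connection X p u = tangent_proj p (sphere_deriv X p u)"

text \<open>The divergence is the trace of \<open>u \<mapsto> \<nabla>\<^sub>u X\<close> on the tangent space.  It is computed in the
  ambient space, after extending this endomorphism by zero on the normal line.\<close>

definition sphere_div :: "('a::euclidean_space \<Rightarrow> 'a) \<Rightarrow> 'a \<Rightarrow> real" where
  "sphere_div X p = (\<Sum>b\<in>Basis. sphere_connection X p (tangent_proj p b) \<bullet> b)"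

definition laplace_beltrami :: "('a::euclidean_space \<Rightarrow> real) \<Rightarrow> 'a \<Rightarrow> real" where
  "laplace_beltrami f = sphere_div (sphere_grad f)"

text \<open>Riemannian distance: infimum of the lengths of \<open>C\<^sup>1\<close> curves in the sphere.  (The weaker
  library notion \<open>valid_path\<close> admits curves of infinite length, to which the Henstock-Kurzweil
  \<open>integral\<close> would assign the value 0.)\<close>

definition sphere_dist :: "'a::euclidean_space \<Rightarrow> 'a \<Rightarrow> real" where
  "sphere_dist x y =
     Inf {integral {0..1} (\<lambda>t. norm (vector_derivative \<gamma> (at t))) | \<gamma>.
            \<gamma> C1_differentiable_on {0..1} \<and> \<gamma> ` {0..1} \<subseteq> sphere 0 1 \<and> \<gamma> 0 = x \<and> \<gamma> 1 = y}"


section \<open>The quaternionic Hopf fibration\<close>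

text \<open>
  \<open>\<H>\<^sup>n\<^sup>+\<^sup>1\<close> is \<open>\<H>\<^sup>n \<times> \<H>\<close>, where \<open>n = CARD('n)\<close>: \<open>fst q $ j\<close> (for \<open>j :: 'n\<close>) are the first \<open>n\<close>
  coordinates of \<open>q\<close>, and \<open>snd q\<close> is the last one.
\<close>

type_synonym 'n quat_vec = "(quat ^ 'n) \<times> quat"

definition quat_act :: "quat \<Rightarrow> 'n::finite quat_vec \<Rightarrow> 'n quat_vec" where
  "quat_act g q = ((\<chi> j. g * fst q $ j), g * snd q)"

definition vertical_deriv :: "quat \<Rightarrow> ('n::finite quat_vec \<Rightarrow> real) \<Rightarrow> 'n quat_vec \<Rightarrow> real" where
  "vertical_deriv u f q = deriv (\<lambda>\<theta>. f (quat_act (exp (\<theta> *\<^sub>R u)) q)) 0"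

definition sub_laplacian :: "('n::finite quat_vec \<Rightarrow> real) \<Rightarrow> 'n quat_vec \<Rightarrow> real" where
  "sub_laplacian f q = laplace_beltrami f q
     - vertical_deriv quatI (vertical_deriv quatI f) q
     - vertical_deriv quatJ (vertical_deriv quatJ f) q
     - vertical_deriv quatK (vertical_deriv quatK f) q"

text \<open>Coordinates, meaningful where \<open>snd q \<noteq> 0\<close>.  Here \<open>a / b = a * inverse b\<close>, by definition.\<close>

definition hopf_rho :: "'n::finite quat_vec \<Rightarrow> real" where
  "hopf_rho q = sqrt (\<Sum>j\<in>UNIV. (norm (fst q $ j / snd q))\<^sup>2)"

definition hopf_eta :: "'n::finite quat_vec \<Rightarrow> real" where
  "hopf_eta q = sphere_dist 1 (snd q /\<^sub>R norm (snd q))"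

definition hopf_psi :: "'n::finite quat_vec \<Rightarrow> real \<times> real" where
  "hopf_psi q = (hopf_rho q, hopf_eta q)"


section \<open>Cylindric test functions\<close>

primrec Ck :: "nat \<Rightarrow> ('a::real_normed_vector \<Rightarrow> 'b::real_normed_vector) \<Rightarrow> bool" where
  "Ck 0 f \<longleftrightarrow> continuous_on UNIV f"
| "Ck (Suc k) f \<longleftrightarrow> (\<forall>x. f differentiable at x) \<and> (\<forall>v. Ck k (\<lambda>x. frechet_derivative f (at x) v))"

definition smooth :: "('a::real_normed_vector \<Rightarrow> 'b::real_normed_vector) \<Rightarrow> bool" where
  "smooth f \<longleftrightarrow> (\<forall>k. Ck k f)"

text \<open>
  Smooth compactly supported functions on \<open>\<real>\<^sub>\<ge>\<^sub>0 \<times> \<real>/2\<pi>\<int>\<close>, as functions on \<open>\<real> \<times> \<real>\<close> whose values at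
  negative \<open>\<rho>\<close> are irrelevant: \<open>2\<pi>\<close>-periodic in \<open>\<eta>\<close>, smooth up to the boundary \<open>\<rho> = 0\<close> (that is,
  with a smooth extension across it), and vanishing for large \<open>\<rho>\<close>.
\<close>

definition cyl_test_functions :: "(real \<times> real \<Rightarrow> real) set" where
  "cyl_test_functions = {f.
     (\<exists>g. smooth g \<and> (\<forall>\<rho>\<ge>0. \<forall>\<eta>. f (\<rho>, \<eta>) = g (\<rho>, \<eta>))) \<and>
     (\<forall>\<rho>\<ge>0. \<forall>\<eta>. f (\<rho>, \<eta> + 2 * pi) = f (\<rho>, \<eta>)) \<and>
     (\<exists>R. \<forall>\<rho>>R. \<forall>\<eta>. f (\<rho>, \<eta>) = 0)}"

text \<open>The operator of the proposition, acting on functions of \<open>(r, \<eta>)\<close>.\<close>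

definition cylindric_operator :: "nat \<Rightarrow> (real \<Rightarrow> real \<Rightarrow> real) \<Rightarrow> real \<Rightarrow> real \<Rightarrow> real" where
  "cylindric_operator n F r \<eta> =
     (deriv ^^ 2) (\<lambda>s. F s \<eta>) r
     + ((4 * real n - 1) * cot r - 3 * tan r) * deriv (\<lambda>s. F s \<eta>) r
     + (tan r)\<^sup>2 * ((deriv ^^ 2) (F r) \<eta> + 2 * cot \<eta> * deriv (F r) \<eta>)"

end

theory Submission
  imports Defs
begin

text \<open>
  The function \<open>f \<circ> \<psi>\<close> is homogeneous of degree 0 on the ambient space, so its Laplace--Beltrami
  operator on the sphere is its ambient Laplacian, which the chain rule expresses through the
  gradients and Laplacians of \<open>\<rho> = |x| / |y|\<close> and \<open>\<eta> = arccos (Re y / |y|)\<close>, where \<open>q = (x, y)\<close>;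
  the two gradients are orthogonal.  Along the vertical flows \<open>\<rho>\<close> is constant and \<open>Re y / |y|\<close> is a
  combination of \<open>cos \<theta>\<close> and \<open>sin \<theta>\<close>, so the \<open>T\<^sub>i\<^sup>2\<close> are ordinary second derivatives, and their sum is
  the radial Laplacian of the three-sphere.
\<close>

text \<open>The coefficients have separate origins. In the \<eta> direction the ambient Laplacian
  gives the radial operator of the three-sphere divided by |y|^2 = cos^2 r; the fibres remove that
  operator once, and 1 / cos^2 r - 1 = tan^2 r. The number 4n - 1 is the real dimension of the first
  block less one, from the Laplacian of |x|. The number -3 is -1, from the Laplacian of 1 / |y| in
  dimension four, and -2, from rewriting second derivatives in \<rho> = tan r as derivatives in r.
  The obstacle is that the definitions are intrinsic: the gradient is a definite description over
  tangent vectors, and \<eta> is an infimum of path lengths. Euler's relation in degree 0 makes the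
  ambient gradient tangent, which settles the first; comparison with great circles settles the
  second. Moreover \<open>f\<close> is controlled only for \<rho> >= 0, so derivatives are taken of
  a smooth extension.\<close>

section \<open>Gradients and Laplacians in Euclidean spaces\<close>

text \<open>A gradient field near \<open>p\<close> that is differentiable at \<open>p\<close> is all
  that a second-order chain rule consumes. As a relation carrying explicit values it lets gradients
  and Laplacians be computed by composing rules, and over the reals it describes the first two
  ordinary derivatives.\<close>

definition has_gradient_laplacian ::
    "('a::euclidean_space \<Rightarrow> real) \<Rightarrow> 'a \<Rightarrow> real \<Rightarrow> 'a \<Rightarrow> bool" where
  "has_gradient_laplacian F v L p \<longleftrightarrow>
     (\<exists>G G'. (\<forall>\<^sub>F x in nhds p. (F has_derivative (\<lambda>h. G x \<bullet> h)) (at x)) \<and>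
        (G has_derivative G') (at p) \<and> G p = v \<and> (\<Sum>b\<in>Basis. G' b \<bullet> b) = L)"

lemma has_gradient_laplacianI:
  assumes "\<forall>\<^sub>F x in nhds p. (F has_derivative (\<lambda>h. G x \<bullet> h)) (at x)"
    and "(G has_derivative G') (at p)" "G p = v" "(\<Sum>b\<in>Basis. G' b \<bullet> b) = L"
  shows "has_gradient_laplacian F v L p"
  using assms unfolding has_gradient_laplacian_def by blast

lemma has_gradient_laplacian_cong:
  assumes "has_gradient_laplacian F v L p" "\<forall>\<^sub>F x in nhds p. F x = F' x"
  shows "has_gradient_laplacian F' v L p"
proof -
  from assms(1) obtain G G' where
    G: "\<forall>\<^sub>F x in nhds p. (F has_derivative (\<lambda>h. G x \<bullet> h)) (at x)"
      "(G has_derivative G') (at p)" "G p = v" "(\<Sum>b\<in>Basis. G' b \<bullet> b) = L"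
    unfolding has_gradient_laplacian_def by blast
  \<comment> \<open>Transporting the derivative at a nearby point \<open>x\<close> requires
    agreement on a neighbourhood of \<open>x\<close>, not merely at \<open>x\<close>.\<close>
  have "\<forall>\<^sub>F x in nhds p. \<forall>\<^sub>F y in nhds x. F y = F' y"
    using assms(2) by (simp add: eventually_eventually)
  with G(1) have "\<forall>\<^sub>F x in nhds p. (F' has_derivative (\<lambda>h. G x \<bullet> h)) (at x)"
  proof eventually_elim
    case (elim x)
    have "F x = F' x" using elim(2) eventually_nhds_x_imp_x by blast
    moreover have "\<forall>\<^sub>F y in at x. F y = F' y"
      using elim(2) eventually_nhds_conv_at by blast
    ultimately show ?case
      using elim(1) has_derivative_transform_eventually by fastforce
  qed
  then show ?thesis using G(2-4) by (rule has_gradient_laplacianI)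
qed

lemma has_gradient_laplacian_const: "has_gradient_laplacian (\<lambda>_. c) 0 0 p"
  by (rule has_gradient_laplacianI [where G = "\<lambda>_. 0" and G' = "\<lambda>_. 0"]) auto

lemma has_gradient_laplacian_inner: "has_gradient_laplacian (\<lambda>x. a \<bullet> x) a 0 p"
  by (rule has_gradient_laplacianI [where G = "\<lambda>_. a" and G' = "\<lambda>_. 0"])
    (simp_all add: bounded_linear_imp_has_derivative bounded_linear_inner_right)

lemma has_gradient_laplacian_real:
  fixes \<phi> \<phi>1 :: "real \<Rightarrow> real"
  assumes "\<forall>\<^sub>F t in nhds x. (\<phi> has_real_derivative \<phi>1 t) (at t)"
    and "(\<phi>1 has_real_derivative b) (at x)"
  shows "has_gradient_laplacian \<phi> (\<phi>1 x) b x"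
  using assms
  by (intro has_gradient_laplacianI [where G = \<phi>1 and G' = "\<lambda>h. b * h"])
    (simp_all add: has_field_derivative_def mult.commute [of _ b] mult.commute [of _ "\<phi>1 _"])

section \<open>Functions of one factor of a product; chain and product rules\<close>

lemma sum_Basis_prod:
  fixes f :: "'a::euclidean_space \<times> 'b::euclidean_space \<Rightarrow> real"
  shows "sum f Basis = (\<Sum>i\<in>Basis. f (i, 0)) + (\<Sum>i\<in>Basis. f (0, i))"
proof -
  have "inj_on (\<lambda>u. (u::'a, 0::'b)) Basis" "inj_on (\<lambda>u. (0::'a, u::'b)) Basis"
    by (auto intro!: inj_onI)
  then show ?thesis
    unfolding Basis_prod_def
    by (subst sum.union_disjoint) (auto simp: Basis_prod_def sum.reindex)
qed

lemma has_gradient_laplacian_fst: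
  fixes p :: "'a::euclidean_space \<times> 'b::euclidean_space"
  assumes "has_gradient_laplacian F v L (fst p)"
  shows "has_gradient_laplacian (\<lambda>x. F (fst x)) (v, 0) L p"
proof -
  from assms obtain G G' where
    G: "\<forall>\<^sub>F x in nhds (fst p). (F has_derivative (\<lambda>h. G x \<bullet> h)) (at x)"
      "(G has_derivative G') (at (fst p))" "G (fst p) = v" "(\<Sum>b\<in>Basis. G' b \<bullet> b) = L"
    unfolding has_gradient_laplacian_def by blast
  interpret G': bounded_linear G' using G(2) by (rule has_derivative_bounded_linear)
  have "filterlim fst (nhds (fst p)) (nhds p)"
    by (intro tendsto_fst filterlim_ident)
  from eventually_compose_filterlim [OF G(1) this]
  have "\<forall>\<^sub>F x in nhds p. (F has_derivative (\<lambda>h. G (fst x) \<bullet> h)) (at (fst x))"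
    .
  then have "\<forall>\<^sub>F x in nhds p. ((\<lambda>x. F (fst x)) has_derivative (\<lambda>h. (G (fst x), 0) \<bullet> h)) (at x)"
  proof eventually_elim
    case (elim x)
    show ?case
      using has_derivative_compose [OF has_derivative_fst [OF has_derivative_ident] elim]
      by (simp add: inner_prod_def)
  qed
  moreover have "((\<lambda>x. (G (fst x), 0::'b)) has_derivative (\<lambda>h. (G' (fst h), 0))) (at p)"
    using has_derivative_compose [OF has_derivative_fst [OF has_derivative_ident] G(2)]
    by (auto intro!: derivative_eq_intros)
  ultimately show ?thesis
    by (rule has_gradient_laplacianI) (use G(3,4) in \<open>simp_all add: sum_Basis_prod G'.zero\<close>)
qed

lemma has_gradient_laplacian_snd:
  fixes p :: "'a::euclidean_space \<times> 'b::euclidean_space"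
  assumes "has_gradient_laplacian F v L (snd p)"
  shows "has_gradient_laplacian (\<lambda>x. F (snd x)) (0, v) L p"
proof -
  from assms obtain G G' where
    G: "\<forall>\<^sub>F x in nhds (snd p). (F has_derivative (\<lambda>h. G x \<bullet> h)) (at x)"
      "(G has_derivative G') (at (snd p))" "G (snd p) = v" "(\<Sum>b\<in>Basis. G' b \<bullet> b) = L"
    unfolding has_gradient_laplacian_def by blast
  interpret G': bounded_linear G' using G(2) by (rule has_derivative_bounded_linear)
  have "filterlim snd (nhds (snd p)) (nhds p)"
    by (intro tendsto_snd filterlim_ident)
  from eventually_compose_filterlim [OF G(1) this]
  have "\<forall>\<^sub>F x in nhds p. (F has_derivative (\<lambda>h. G (snd x) \<bullet> h)) (at (snd x))"
    .
  then have "\<forall>\<^sub>F x in nhds p. ((\<lambda>x. F (snd x)) has_derivative (\<lambda>h. (0, G (snd x)) \<bullet> h)) (at x)"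
  proof eventually_elim
    case (elim x)
    show ?case
      using has_derivative_compose [OF has_derivative_snd [OF has_derivative_ident] elim]
      by (simp add: inner_prod_def)
  qed
  moreover have "((\<lambda>x. (0::'a, G (snd x))) has_derivative (\<lambda>h. (0, G' (snd h)))) (at p)"
    using has_derivative_compose [OF has_derivative_snd [OF has_derivative_ident] G(2)]
    by (auto intro!: derivative_eq_intros)
  ultimately show ?thesis
    by (rule has_gradient_laplacianI) (use G(3,4) in \<open>simp_all add: sum_Basis_prod G'.zero\<close>)
qed

text \<open>The Laplacian is the trace of the derivative of the gradient. The mixed partials
  \<open>b\<close> and \<open>c\<close> of the outer function enter only as a factor of
  \<open>v1 \<bullet> v2\<close>, so they disappear when the inner functions have orthogonal
  gradients.\<close>

lemma has_gradient_laplacian_compose2: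
  fixes \<Phi> \<Phi>1 \<Phi>2 :: "real \<times> real \<Rightarrow> real"
  assumes "has_gradient_laplacian u v1 L1 p" "has_gradient_laplacian w v2 L2 p"
    and \<Phi>: "\<forall>\<^sub>F z in nhds (u p, w p).
      (\<Phi> has_derivative (\<lambda>h. \<Phi>1 z * fst h + \<Phi>2 z * snd h)) (at z)"
    and \<Phi>1: "(\<Phi>1 has_derivative (\<lambda>h. a * fst h + b * snd h)) (at (u p, w p))"
    and \<Phi>2: "(\<Phi>2 has_derivative (\<lambda>h. c * fst h + d * snd h)) (at (u p, w p))"
  shows "has_gradient_laplacian (\<lambda>x. \<Phi> (u x, w x))
    (\<Phi>1 (u p, w p) *\<^sub>R v1 + \<Phi>2 (u p, w p) *\<^sub>R v2)
    (a * (v1 \<bullet> v1) + (b + c) * (v1 \<bullet> v2) + d * (v2 \<bullet> v2)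
      + \<Phi>1 (u p, w p) * L1 + \<Phi>2 (u p, w p) * L2) p"
proof -
  from assms(1) obtain G G' where
    G: "\<forall>\<^sub>F x in nhds p. (u has_derivative (\<lambda>h. G x \<bullet> h)) (at x)"
      "(G has_derivative G') (at p)" "G p = v1" "(\<Sum>b\<in>Basis. G' b \<bullet> b) = L1"
    unfolding has_gradient_laplacian_def by blast
  from assms(2) obtain H H' where
    H: "\<forall>\<^sub>F x in nhds p. (w has_derivative (\<lambda>h. H x \<bullet> h)) (at x)"
      "(H has_derivative H') (at p)" "H p = v2" "(\<Sum>b\<in>Basis. H' b \<bullet> b) = L2"
    unfolding has_gradient_laplacian_def by blast
  have up: "(u has_derivative (\<lambda>h. v1 \<bullet> h)) (at p)"
    using G(1,3) eventually_nhds_x_imp_x by blast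
  have wp: "(w has_derivative (\<lambda>h. v2 \<bullet> h)) (at p)"
    using H(1,3) eventually_nhds_x_imp_x by blast
  have uw: "((\<lambda>x. (u x, w x)) has_derivative (\<lambda>h. (v1 \<bullet> h, v2 \<bullet> h))) (at p)"
    using up wp by (rule has_derivative_Pair)
  have "isCont (\<lambda>x. (u x, w x)) p"
    using uw has_derivative_continuous by blast
  then have "filterlim (\<lambda>x. (u x, w x)) (nhds (u p, w p)) (nhds p)"
    using tendsto_at_iff_tendsto_nhds unfolding isCont_def by blast
  from eventually_compose_filterlim [OF \<Phi> this]
  have "\<forall>\<^sub>F x in nhds p. (\<Phi> has_derivative
      (\<lambda>h. \<Phi>1 (u x, w x) * fst h + \<Phi>2 (u x, w x) * snd h)) (at (u x, w x))"
    .
  with G(1) H(1) have 1: "\<forall>\<^sub>F x in nhds p. ((\<lambda>x. \<Phi> (u x, w x)) has_derivative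
      (\<lambda>h. (\<Phi>1 (u x, w x) *\<^sub>R G x + \<Phi>2 (u x, w x) *\<^sub>R H x) \<bullet> h)) (at x)"
  proof eventually_elim
    case (elim x)
    show ?case
      using has_derivative_compose [OF has_derivative_Pair [OF elim(1,2)] elim(3)]
      by (simp add: inner_add_left)
  qed
  have 2: "((\<lambda>x. \<Phi>1 (u x, w x) *\<^sub>R G x + \<Phi>2 (u x, w x) *\<^sub>R H x) has_derivative
     (\<lambda>h. (a * (v1 \<bullet> h) + b * (v2 \<bullet> h)) *\<^sub>R v1 + \<Phi>1 (u p, w p) *\<^sub>R G' h
        + ((c * (v1 \<bullet> h) + d * (v2 \<bullet> h)) *\<^sub>R v2 + \<Phi>2 (u p, w p) *\<^sub>R H' h))) (at p)"
    using has_derivative_compose [OF uw \<Phi>1] has_derivative_compose [OF uw \<Phi>2] G(2,3) H(2,3)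
    by (auto intro!: derivative_eq_intros simp: algebra_simps)
  \<comment> \<open>The second partials contribute rank-one maps, and the trace of
    \<open>h \<mapsto> (x \<bullet> h) *\<^sub>R y\<close> is \<open>x \<bullet> y\<close>.\<close>
  have e: "(\<Sum>b\<in>Basis. (x \<bullet> b) * (y \<bullet> b)) = x \<bullet> y" for x y :: 'a
    by (rule euclidean_inner [symmetric])
  show ?thesis
  proof (rule has_gradient_laplacianI [OF 1 2])
    show "(\<Sum>k\<in>Basis. ((a * (v1 \<bullet> k) + b * (v2 \<bullet> k)) *\<^sub>R v1 + \<Phi>1 (u p, w p) *\<^sub>R G' k
        + ((c * (v1 \<bullet> k) + d * (v2 \<bullet> k)) *\<^sub>R v2 + \<Phi>2 (u p, w p) *\<^sub>R H' k)) \<bullet> k)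
      = a * (v1 \<bullet> v1) + (b + c) * (v1 \<bullet> v2) + d * (v2 \<bullet> v2)
      + \<Phi>1 (u p, w p) * L1 + \<Phi>2 (u p, w p) * L2" (is "?l = _")
    proof -
      have "?l = (\<Sum>k\<in>Basis. a * ((v1 \<bullet> k) * (v1 \<bullet> k)) + b * ((v1 \<bullet> k) * (v2 \<bullet> k))
         + c * ((v1 \<bullet> k) * (v2 \<bullet> k)) + d * ((v2 \<bullet> k) * (v2 \<bullet> k))
         + \<Phi>1 (u p, w p) * (G' k \<bullet> k) + \<Phi>2 (u p, w p) * (H' k \<bullet> k))"
        by (intro sum.cong) (auto simp: inner_add_left algebra_simps)
      also have "\<dots> = a * (v1 \<bullet> v1) + b * (v1 \<bullet> v2) + c * (v1 \<bullet> v2) + d * (v2 \<bullet> v2)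
          + \<Phi>1 (u p, w p) * L1 + \<Phi>2 (u p, w p) * L2"
        by (simp only: sum.distrib sum_distrib_left [symmetric] e G(4) H(4))
      finally show ?thesis by (simp add: algebra_simps)
    qed
  qed (simp add: G H)
qed

text \<open>The two-variable rule with the constant 0 as second inner function and an outer function
  that ignores its second argument.\<close>

lemma has_gradient_laplacian_compose:
  assumes u: "has_gradient_laplacian u v L p"
    and \<phi>: "\<forall>\<^sub>F t in nhds (u p). (\<phi> has_real_derivative \<phi>1 t) (at t)"
    and \<phi>1: "(\<phi>1 has_real_derivative b) (at (u p))"
  shows "has_gradient_laplacian (\<lambda>x. \<phi> (u x)) (\<phi>1 (u p) *\<^sub>R v) (b * (v \<bullet> v) + \<phi>1 (u p) * L) p"
proof -
  have "filterlim fst (nhds (u p)) (nhds (u p, 0::real))"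
    using tendsto_fst [OF filterlim_ident, of "(u p, 0::real)"] by simp
  from eventually_compose_filterlim [OF \<phi> this]
  have "\<forall>\<^sub>F z in nhds (u p, 0::real). (\<phi> has_real_derivative \<phi>1 (fst z)) (at (fst z))"
    .
  then have 1: "\<forall>\<^sub>F z in nhds (u p, 0::real).
      ((\<lambda>z. \<phi> (fst z)) has_derivative (\<lambda>h. \<phi>1 (fst z) * fst h + 0 * snd h)) (at z)"
  proof eventually_elim
    case (elim z)
    then show ?case
      using has_derivative_compose [OF has_derivative_fst [OF has_derivative_ident],
          of \<phi> "\<lambda>h. \<phi>1 (fst z) * h" z UNIV]
      by (simp add: has_field_derivative_def)
  qed
  have 2: "((\<lambda>z. \<phi>1 (fst z)) has_derivative (\<lambda>h. b * fst h + 0 * snd h)) (at (u p, 0::real))"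
    using has_derivative_compose [OF has_derivative_fst [OF has_derivative_ident],
          of \<phi>1 "\<lambda>h. b * h" "(u p, 0::real)" UNIV] \<phi>1
    by (simp add: has_field_derivative_def)
  have 3: "((\<lambda>z. 0) has_derivative (\<lambda>h. 0 * fst h + 0 * snd h)) (at (u p, 0::real))"
    by simp
  show ?thesis
    using has_gradient_laplacian_compose2 [OF u has_gradient_laplacian_const 1 2 3] by simp
qed

lemma has_gradient_laplacian_mult:
  assumes u: "has_gradient_laplacian u v1 L1 p" and w: "has_gradient_laplacian w v2 L2 p"
  shows "has_gradient_laplacian (\<lambda>x. u x * w x) (w p *\<^sub>R v1 + u p *\<^sub>R v2)
    (2 * (v1 \<bullet> v2) + w p * L1 + u p * L2) p"
proof -
  have "\<forall>\<^sub>F z in nhds (u p, w p).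
      ((\<lambda>z. fst z * snd z) has_derivative (\<lambda>h. snd z * fst h + fst z * snd h)) (at z)"
    by (auto intro!: derivative_eq_intros always_eventually simp: mult_ac)
  from has_gradient_laplacian_compose2 [OF u w this, of 0 1 1 0] show ?thesis
    by (simp add: has_derivative_fst has_derivative_snd)
qed

section \<open>The norm, its reciprocal, and the angle to a fixed unit vector\<close>

lemma has_gradient_laplacian_inner_self:
  fixes p :: "'a::euclidean_space"
  shows "has_gradient_laplacian (\<lambda>x. x \<bullet> x) (2 *\<^sub>R p) (2 * real DIM('a)) p"
proof -
  have "(\<Sum>b\<in>Basis. 2 *\<^sub>R b \<bullet> (b::'a)) = (\<Sum>b\<in>(Basis::'a set). 2)"
    by (intro sum.cong) auto
  then show ?thesis
    by (intro has_gradient_laplacianI [where G = "\<lambda>x. 2 *\<^sub>R x" and G' = "\<lambda>h. 2 *\<^sub>R h"])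
      (auto intro!: derivative_eq_intros always_eventually simp: inner_commute)
qed

lemma has_gradient_laplacian_norm:
  fixes p :: "'a::euclidean_space"
  assumes "p \<noteq> 0"
  shows "has_gradient_laplacian norm (p /\<^sub>R norm p) ((real DIM('a) - 1) / norm p) p"
proof -
  have pos: "p \<bullet> p > 0" using assms by simp
  have n: "norm p > 0" "p \<bullet> p = norm p * norm p" "sqrt (p \<bullet> p) = norm p"
    using assms by (auto simp: norm_eq_sqrt_inner)
  have "\<forall>\<^sub>F t in nhds (p \<bullet> p). 0 < t"
    using pos by (intro eventually_nhds_in_open [of "{0<..}", simplified]) auto
  then have 1: "\<forall>\<^sub>F t in nhds (p \<bullet> p). (sqrt has_real_derivative 1 / (2 * sqrt t)) (at t)"
    by eventually_elim (auto intro!: derivative_eq_intros simp: divide_simps)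
  have 2: "((\<lambda>t. 1 / (2 * sqrt t)) has_real_derivative (- 1 / (4 * norm p ^ 3))) (at (p \<bullet> p))"
    using pos n by (auto intro!: derivative_eq_intros simp: divide_simps power3_eq_cube)
  have "has_gradient_laplacian (\<lambda>x. sqrt (x \<bullet> x)) (p /\<^sub>R norm p) ((real DIM('a) - 1) / norm p) p"
    using has_gradient_laplacian_compose [OF has_gradient_laplacian_inner_self 1 2] n
    by (simp add: divide_simps power3_eq_cube)
  then show ?thesis by (simp add: norm_eq_sqrt_inner [symmetric])
qed

text \<open>In dimension 4 the numerator is -1, one of the three units in the coefficient
  \<open>- 3 * tan r\<close> of the final operator.\<close>

lemma has_gradient_laplacian_inverse_norm:
  fixes p :: "'a::euclidean_space"
  assumes "p \<noteq> 0"
  shows "has_gradient_laplacian (\<lambda>x. inverse (norm x)) (- (p /\<^sub>R norm p ^ 3))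
    ((3 - real DIM('a)) / norm p ^ 3) p"
proof -
  have n: "norm p > 0" "p \<bullet> p = norm p * norm p"
    using assms by (auto simp: norm_eq_sqrt_inner)
  have "\<forall>\<^sub>F t in nhds (norm p). 0 < t"
    using n(1) by (intro eventually_nhds_in_open [of "{0<..}", simplified]) auto
  then have 1: "\<forall>\<^sub>F t in nhds (norm p). (inverse has_real_derivative (- 1 / t\<^sup>2)) (at t)"
    by eventually_elim (auto intro!: derivative_eq_intros simp: divide_simps power2_eq_square)
  have 2: "((\<lambda>t. - 1 / t\<^sup>2) has_real_derivative (2 / norm p ^ 3)) (at (norm p))"
    using n(1) by (auto intro!: derivative_eq_intros simp: divide_simps eval_nat_numeral)
  show ?thesis
    using has_gradient_laplacian_compose [OF has_gradient_laplacian_norm [OF assms] 1 2] n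
    by (simp add: divide_simps eval_nat_numeral) (simp add: field_simps)
qed

text \<open>The bridge back to ordinary calculus: it evaluates both the vertical second derivatives
  and the \<open>deriv\<close> terms of the target operator.\<close>

lemma has_gradient_laplacian_deriv:
  fixes F :: "real \<Rightarrow> real"
  assumes "has_gradient_laplacian F v L x"
  shows "deriv F x = v" "(deriv ^^ 2) F x = L"
proof -
  from assms obtain G G' where
    G: "\<forall>\<^sub>F x in nhds x. (F has_derivative (\<lambda>h. G x \<bullet> h)) (at x)"
      "(G has_derivative G') (at x)" "G x = v" "(\<Sum>b\<in>Basis. G' b \<bullet> b) = L"
    unfolding has_gradient_laplacian_def by blast
  have d: "\<forall>\<^sub>F x in nhds x. deriv F x = G x"
    using G(1) by eventually_elim (auto intro!: DERIV_imp_deriv simp: has_field_derivative_def)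
  then show "deriv F x = v" using G(3) eventually_nhds_x_imp_x by blast
  \<comment> \<open>The basis of the real line is {1}, so the trace is a single value.\<close>
  have "G' 1 = L" using G(4) by simp
  then have "G' = (\<lambda>h. L * h)"
    using linear_cmul [OF has_derivative_linear [OF G(2)], of h 1 for h] by (intro ext) auto
  with G(2) have "(G has_real_derivative L) (at x)"
    by (simp add: has_field_derivative_def)
  moreover have "deriv (deriv F) x = deriv G x"
    using d by (rule deriv_cong_ev) simp
  ultimately show "(deriv ^^ 2) F x = L"
    by (simp add: numeral_2_eq_2 DERIV_imp_deriv)
qed

lemma has_gradient_laplacian_arccos:
  fixes u :: "'a::euclidean_space \<Rightarrow> real"
  assumes u: "has_gradient_laplacian u v L p" and c: "\<bar>u p\<bar> < 1"
  defines "s \<equiv> sqrt (1 - (u p)\<^sup>2)"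
  shows "has_gradient_laplacian (\<lambda>x. arccos (u x)) (- inverse s *\<^sub>R v)
    (- u p / s ^ 3 * (v \<bullet> v) + - inverse s * L) p"
proof -
  have "(u p)\<^sup>2 < 1" using c by (simp add: abs_square_less_1)
  then have s: "s > 0" by (simp add: s_def)
  have "\<forall>\<^sub>F t in nhds (u p). t \<in> {- 1 <..< 1}"
    using c by (intro eventually_nhds_in_open) auto
  then have 1: "\<forall>\<^sub>F t in nhds (u p). (arccos has_real_derivative - inverse (sqrt (1 - t\<^sup>2))) (at t)"
    by eventually_elim (use DERIV_arccos in \<open>auto simp: inverse_minus_eq\<close>)
  have 2: "((\<lambda>t. - inverse (sqrt (1 - t\<^sup>2))) has_real_derivative - u p / s ^ 3) (at (u p))"
    using \<open>(u p)\<^sup>2 < 1\<close> s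
    by (auto intro!: derivative_eq_intros simp: s_def [symmetric] power3_eq_cube field_simps)
  show ?thesis
    using has_gradient_laplacian_compose [OF u 1 2] by (simp add: s_def)
qed

text \<open>The cosine of the angle has a gradient of length \<open>s / norm p\<close>, and
  composing with \<open>arccos\<close> divides by \<open>s\<close>. In the Laplacian the cosine
  contributes \<open>DIM('a) - 1\<close> copies of the cotangent term, and the second derivative of
  \<open>arccos\<close> cancels one of them.\<close>

lemma has_gradient_laplacian_angle:
  fixes p e :: "'a::euclidean_space" and c s :: real
  defines "c \<equiv> e \<bullet> p / norm p" and "s \<equiv> sqrt (1 - c\<^sup>2)"
  assumes e: "norm e = 1" and p: "p \<noteq> 0" and c: "\<bar>c\<bar> < 1"
  obtains v where "has_gradient_laplacian (\<lambda>x. arccos (e \<bullet> x / norm x)) v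
      ((real DIM('a) - 2) * c / (s * (norm p)\<^sup>2)) p"
    and "v \<bullet> p = 0" and "v \<bullet> v = 1 / (norm p)\<^sup>2"
proof -
  define N where "N = norm p"
  have N: "N > 0" "p \<bullet> p = N\<^sup>2" using p by (auto simp: N_def power2_norm_eq_inner)
  have ep: "e \<bullet> p = c * N" "p \<bullet> e = c * N" using N by (auto simp: c_def N_def inner_commute)
  have ee: "e \<bullet> e = 1" using e by (simp add: norm_eq_1)
  have c2: "c\<^sup>2 < 1" using c by (simp add: abs_square_less_1)
  then have s: "s > 0" "s\<^sup>2 = 1 - c\<^sup>2" by (auto simp: s_def)
  \<comment> \<open>The component of \<open>e\<close> orthogonal to \<open>p\<close>, divided by
    \<open>N\<close>; it is the gradient of the cosine at \<open>p\<close>.\<close>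
  define w where "w = (1 / N) *\<^sub>R e - (c / N\<^sup>2) *\<^sub>R p"
  have w: "w \<bullet> p = 0" "w \<bullet> w = s\<^sup>2 / N\<^sup>2"
    using N(1) unfolding w_def s(2)
    by (simp_all add: inner_diff_left inner_diff_right N(2) ep ee power2_eq_square field_simps)
  have hc: "has_gradient_laplacian (\<lambda>x. e \<bullet> x * inverse (norm x)) w (c * (1 - real DIM('a)) / N\<^sup>2) p"
  proof -
    have "inverse N *\<^sub>R e + (e \<bullet> p) *\<^sub>R - (p /\<^sub>R N ^ 3) = w"
      using N(1) by (simp add: w_def ep power2_eq_square power3_eq_cube field_simps)
    moreover have "2 * (e \<bullet> - (p /\<^sub>R N ^ 3)) + inverse N * 0 + (e \<bullet> p) * ((3 - real DIM('a)) / N ^ 3)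
        = c * (1 - real DIM('a)) / N\<^sup>2"
      using N(1) by (simp add: ep power2_eq_square power3_eq_cube field_simps)
    ultimately show ?thesis
      using has_gradient_laplacian_mult [OF has_gradient_laplacian_inner
          has_gradient_laplacian_inverse_norm [OF p], of e]
      by (simp add: N_def)
  qed
  have cN: "e \<bullet> p * inverse (norm p) = c" by (simp add: c_def divide_inverse)
  have "has_gradient_laplacian (\<lambda>x. arccos (e \<bullet> x * inverse (norm x))) (- inverse s *\<^sub>R w)
      (- c / s ^ 3 * (s\<^sup>2 / N\<^sup>2) + - inverse s * (c * (1 - real DIM('a)) / N\<^sup>2)) p"
    using has_gradient_laplacian_arccos [OF hc] c by (simp add: cN s_def [symmetric] w)
  moreover have "- c / s ^ 3 * (s\<^sup>2 / N\<^sup>2) + - inverse s * (c * (1 - real DIM('a)) / N\<^sup>2)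
      = (real DIM('a) - 2) * c / (s * (norm p)\<^sup>2)"
    using N(1) s(1) by (simp add: N_def [symmetric] power2_eq_square power3_eq_cube field_simps)
  ultimately have "has_gradient_laplacian (\<lambda>x. arccos (e \<bullet> x / norm x)) (- inverse s *\<^sub>R w)
      ((real DIM('a) - 2) * c / (s * (norm p)\<^sup>2)) p"
    by (simp add: divide_inverse)
  moreover have "(- inverse s *\<^sub>R w) \<bullet> p = 0" using w by simp
  moreover have "(- inverse s *\<^sub>R w) \<bullet> (- inverse s *\<^sub>R w) = 1 / (norm p)\<^sup>2"
    using w s(1) N(1) by (simp add: N_def power2_eq_square field_simps)
  ultimately show thesis using that by blast
qed

section \<open>The Laplace--Beltrami operator on homogeneous functions\<close>

text \<open>A tangent direction leaves the norm stationary to first order, so normalizing does not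
  alter the initial velocity.\<close>

lemma sgn_line_has_vector_derivative:
  fixes x u :: "'a::euclidean_space"
  assumes "norm x = 1" "u \<bullet> x = 0"
  shows "((\<lambda>t. sgn (x + t *\<^sub>R u)) has_vector_derivative u) (at 0)"
proof -
  have x0: "x + 0 *\<^sub>R u \<noteq> 0" using assms(1) by auto
  have "((\<lambda>t. norm (x + t *\<^sub>R u)) has_derivative (\<lambda>h. (h *\<^sub>R u) \<bullet> sgn (x + 0 *\<^sub>R u))) (at 0)"
    by (intro has_derivative_compose [of "\<lambda>t. x + t *\<^sub>R u" _ 0 UNIV norm] has_derivative_norm)
      (use x0 in \<open>auto intro!: derivative_eq_intros\<close>)
  then have n: "((\<lambda>t. norm (x + t *\<^sub>R u)) has_real_derivative 0) (at 0)"
    using assms by (simp add: has_field_derivative_def sgn_div_norm lambda_zero)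
  have "((\<lambda>t. inverse (norm (x + t *\<^sub>R u))) has_real_derivative 0) (at 0)"
    using DERIV_inverse_fun [OF n] x0 by simp
  moreover have "((\<lambda>t. x + t *\<^sub>R u) has_vector_derivative u) (at 0)"
    by (auto intro!: derivative_eq_intros)
  ultimately have "((\<lambda>t. inverse (norm (x + t *\<^sub>R u)) *\<^sub>R (x + t *\<^sub>R u)) has_vector_derivative
      (inverse (norm (x + 0 *\<^sub>R u)) *\<^sub>R u + 0 *\<^sub>R (x + 0 *\<^sub>R u))) (at 0)"
    by (rule has_vector_derivative_scaleR)
  then show ?thesis using assms by (simp add: sgn_div_norm)
qed

lemma sphere_deriv_eq:
  assumes "(X has_derivative X') (at x)" "norm x = 1" "u \<bullet> x = 0"
  shows "sphere_deriv X x u = X' u"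
proof -
  have "sgn (x + 0 *\<^sub>R u) = x" using assms(2) by (simp add: sgn_div_norm)
  then have "((X \<circ> (\<lambda>t. sgn (x + t *\<^sub>R u))) has_vector_derivative X' u) (at 0)"
    using assms
    by (intro vector_derivative_diff_chain_within sgn_line_has_vector_derivative)
      (auto intro: has_derivative_at_withinI)
  then show ?thesis
    unfolding sphere_deriv_def o_def by (rule vector_derivative_at)
qed

lemma sphere_grad_eq:
  assumes F: "(F has_derivative (\<lambda>h. v \<bullet> h)) (at x)" and x: "norm x = 1" and v: "v \<bullet> x = 0"
  shows "sphere_grad F x = v"
  unfolding sphere_grad_def
proof (rule the_equality)
  show "v \<in> sphere_tangent x \<and> (\<forall>u\<in>sphere_tangent x. v \<bullet> u = sphere_deriv F x u)"
    using v sphere_deriv_eq [OF F x] by (auto simp: sphere_tangent_def)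
next
  fix v' assume *: "v' \<in> sphere_tangent x \<and> (\<forall>u\<in>sphere_tangent x. v' \<bullet> u = sphere_deriv F x u)"
  \<comment> \<open>Both candidates pair equally with every tangent vector. Their difference is
    itself tangent, hence orthogonal to itself.\<close>
  define d where "d = v' - v"
  have "d \<bullet> x = 0" using * v by (auto simp: d_def sphere_tangent_def inner_diff_left)
  then have "v' \<bullet> d = v \<bullet> d"
    using * sphere_deriv_eq [OF F x] by (auto simp: sphere_tangent_def)
  then have "d \<bullet> d = 0" by (simp add: d_def inner_diff_left)
  then show "v' = v" by (simp add: d_def)
qed

text \<open>Euler's relation in degree 0: \<open>F\<close> is constant along the open ray through
  \<open>x\<close>, and the chain rule differentiates it there at \<open>t = 1\<close>.\<close>

lemma gradient_homogeneous:
  assumes F: "(F has_derivative (\<lambda>h. v \<bullet> h)) (at x)"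
    and hom: "\<And>t. t > 0 \<Longrightarrow> F (t *\<^sub>R x) = F x"
  shows "v \<bullet> x = 0"
proof -
  have "((\<lambda>t. F (t *\<^sub>R x)) has_derivative (\<lambda>h. v \<bullet> (h *\<^sub>R x))) (at 1)"
    using F by (intro has_derivative_compose [of "\<lambda>t. t *\<^sub>R x" _ _ _ F])
      (auto intro!: derivative_eq_intros)
  moreover have "\<forall>\<^sub>F t in nhds 1. F (t *\<^sub>R x) = F x"
    using eventually_nhds_in_open [of "{0<..}" "1::real"] by (auto elim!: eventually_mono simp: hom)
  ultimately have "((\<lambda>t. F x) has_derivative (\<lambda>h. v \<bullet> (h *\<^sub>R x))) (at 1)"
    by (rule has_derivative_transform_eventually
        [OF _ eventually_nhds_conv_at [THEN iffD1, THEN conjunct1]])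
      (simp_all add: hom)
  then have "(\<lambda>h. v \<bullet> (h *\<^sub>R x)) = (\<lambda>h. 0)"
    using has_derivative_unique has_derivative_const by blast
  from fun_cong [OF this, of 1] show ?thesis by simp
qed

text \<open>The radial Hessian entry of a function that is homogeneous of degree 0 vanishes at unit
  vectors, so tracing over the tangent space or over the ambient space makes no difference.\<close>

lemma laplace_beltrami_homogeneous:
  assumes F: "has_gradient_laplacian F v L p" and p: "norm p = 1"
    and hom: "\<And>t x. t > 0 \<Longrightarrow> F (t *\<^sub>R x) = F x"
  shows "laplace_beltrami F p = L"
proof -
  from F obtain G G' where
    G: "\<forall>\<^sub>F x in nhds p. (F has_derivative (\<lambda>h. G x \<bullet> h)) (at x)"
      "(G has_derivative G') (at p)" "G p = v" "(\<Sum>b\<in>Basis. G' b \<bullet> b) = L"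
    unfolding has_gradient_laplacian_def by blast
  interpret G': bounded_linear G' using G(2) by (rule has_derivative_bounded_linear)
  have Gx: "\<forall>\<^sub>F x in nhds p. G x \<bullet> x = 0"
    using G(1) by eventually_elim (rule gradient_homogeneous [where F = F], simp_all add: hom)
  then have Gp: "G p \<bullet> p = 0" using eventually_nhds_x_imp_x by blast
  \<comment> \<open>The intrinsic gradient is identified only at points of the sphere, which
    suffices because the curves in \<open>sphere_deriv\<close> stay on it.\<close>
  have grad: "\<forall>\<^sub>F x in nhds p. norm x = 1 \<longrightarrow> sphere_grad F x = G x"
    using G(1) Gx by eventually_elim (auto intro: sphere_grad_eq)
  \<comment> \<open>Euler's relation holds near \<open>p\<close>, so it may be differentiated; in
    the direction \<open>p\<close> this gives \<open>G p \<bullet> p + G' p \<bullet> p = 0\<close>,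
    whose first term is zero.\<close>
  have "((\<lambda>x. G x \<bullet> x) has_derivative (\<lambda>h. G p \<bullet> h + G' h \<bullet> p)) (at p)"
    using G(2) by (auto intro!: derivative_eq_intros)
  then have "((\<lambda>x. 0) has_derivative (\<lambda>h. G p \<bullet> h + G' h \<bullet> p)) (at p)"
    by (rule has_derivative_transform_eventually
        [OF _ eventually_nhds_conv_at [THEN iffD1, THEN conjunct1, OF Gx]]) (simp_all add: Gp)
  then have "(\<lambda>h. G p \<bullet> h + G' h \<bullet> p) = (\<lambda>h. 0)"
    using has_derivative_unique has_derivative_const by blast
  from fun_cong [OF this, of p] have G'pp: "G' p \<bullet> p = 0" by (simp add: Gp)
  have deriv: "sphere_deriv (sphere_grad F) p u = G' u" if u: "u \<bullet> p = 0" for u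
  proof -
    have c: "((\<lambda>t. sgn (p + t *\<^sub>R u)) has_vector_derivative u) (at 0)"
      using p u by (rule sgn_line_has_vector_derivative)
    then have "isCont (\<lambda>t. sgn (p + t *\<^sub>R u)) 0"
      by (rule has_vector_derivative_continuous)
    then have "filterlim (\<lambda>t. sgn (p + t *\<^sub>R u)) (nhds p) (nhds 0)"
      using p tendsto_at_iff_tendsto_nhds [of "\<lambda>t. sgn (p + t *\<^sub>R u)" 0]
      by (simp add: isCont_def sgn_div_norm)
    from eventually_compose_filterlim [OF grad this]
    have e: "\<forall>\<^sub>F t in nhds 0. sphere_grad F (sgn (p + t *\<^sub>R u)) = G (sgn (p + t *\<^sub>R u))"
    proof -
      \<comment> \<open>\<open>sgn 0 = 0\<close> does not lie on the sphere, so the zero vector has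
        to be avoided.\<close>
      have "\<forall>\<^sub>F t in nhds 0. p + t *\<^sub>R u \<noteq> 0"
        using p by (intro eventually_nhds_in_open [of "{t. p + t *\<^sub>R u \<noteq> 0}", simplified])
          (auto intro!: open_Collect_neq continuous_intros)
      with \<open>\<forall>\<^sub>F t in nhds 0. norm (sgn (p + t *\<^sub>R u)) = 1 \<longrightarrow> _ t\<close> show ?thesis
        by eventually_elim (auto simp: norm_sgn)
    qed
    have "sphere_deriv (sphere_grad F) p u = sphere_deriv G p u"
      unfolding sphere_deriv_def using e
      by (intro vector_derivative_cong_eq) auto
    also have "\<dots> = G' u" using G(2) p u by (rule sphere_deriv_eq)
    finally show ?thesis .
  qed
  have pp: "p \<bullet> p = 1" using p by (simp add: norm_eq_1)
  \<comment> \<open>Expanding both projections leaves two correction terms; summed over the basis,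
    each is the radial entry \<open>G' p \<bullet> p\<close>.\<close>
  have "sphere_connection (sphere_grad F) p (tangent_proj p b) \<bullet> b
      = G' b \<bullet> b - (p \<bullet> b) * (G' p \<bullet> b) - (p \<bullet> b) * (G' b \<bullet> p)" for b
    using pp by (simp add: sphere_connection_def tangent_proj_def deriv inner_diff_left inner_diff_right
        G'.diff G'.scale G'pp inner_commute [of b p] algebra_simps)
  then have "laplace_beltrami F p =
      (\<Sum>b\<in>Basis. G' b \<bullet> b - (p \<bullet> b) * (G' p \<bullet> b) - (p \<bullet> b) * (G' b \<bullet> p))"
    by (simp add: laplace_beltrami_def sphere_div_def)
  also have "\<dots> = L - p \<bullet> G' p - G' (\<Sum>b\<in>Basis. (p \<bullet> b) *\<^sub>R b) \<bullet> p"
    unfolding euclidean_inner [of p "G' p"]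
    by (simp add: sum_subtractf G(4) G'.sum G'.scale inner_sum_left)
  also have "\<dots> = L" unfolding euclidean_representation using G'pp by (simp add: inner_commute)
  finally show ?thesis .
qed

section \<open>The Riemannian distance of the sphere\<close>

text \<open>The angle from the starting point grows no faster than arc length; integrating this
  bound on its derivative gives the estimate.\<close>

lemma C1_sphere_path_length_ge:
  fixes \<gamma> :: "real \<Rightarrow> 'a::euclidean_space"
  assumes C1: "\<gamma> C1_differentiable_on {0..1}" and sph: "\<gamma> ` {0..1} \<subseteq> sphere 0 1"
  shows "arccos (\<gamma> 0 \<bullet> \<gamma> 1) \<le> integral {0..1} (\<lambda>t. norm (vector_derivative \<gamma> (at t)))"
proof -
  obtain D where D: "\<And>t. t \<in> {0..1} \<Longrightarrow> (\<gamma> has_vector_derivative D t) (at t)"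
      and cD: "continuous_on {0..1} D"
    using C1 unfolding C1_differentiable_on_def by blast
  define c where "c t = \<gamma> 0 \<bullet> \<gamma> t" for t
  define len where "len = integral {0..1} (\<lambda>t. norm (D t))"
  have n1: "norm (\<gamma> t) = 1" if "t \<in> {0..1}" for t
    using sph that by (simp add: image_subset_iff)
  have c1: "\<bar>c t\<bar> \<le> 1" if "t \<in> {0..1}" for t
    using Cauchy_Schwarz_ineq2 [of "\<gamma> 0" "\<gamma> t"] n1 that by (simp add: c_def)
  have \<gamma>D: "((\<lambda>t. \<gamma> t) has_derivative (\<lambda>h. h *\<^sub>R D t)) (at t within {0..1})" if "t \<in> {0..1}" for t
    using D [OF that] has_derivative_at_withinI unfolding has_vector_derivative_def by blast
  have orth: "\<gamma> t \<bullet> D t = 0" if t: "t \<in> {0..1}" for t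
  proof -
    have "((\<lambda>s. \<gamma> s \<bullet> \<gamma> s) has_derivative (\<lambda>h. \<gamma> t \<bullet> (h *\<^sub>R D t) + (h *\<^sub>R D t) \<bullet> \<gamma> t)) (at t within {0..1})"
      using \<gamma>D [OF t] by (auto intro!: derivative_eq_intros)
    then have "((\<lambda>s. \<gamma> s \<bullet> \<gamma> s) has_vector_derivative 2 * (\<gamma> t \<bullet> D t)) (at t within {0..1})"
      by (simp add: has_vector_derivative_def inner_commute algebra_simps)
    moreover have "((\<lambda>s. \<gamma> s \<bullet> \<gamma> s) has_vector_derivative 0) (at t within {0..1})"
      by (rule has_vector_derivative_transform [where f = "\<lambda>_. 1"])
        (use t n1 in \<open>auto simp: norm_eq_1\<close>)
    ultimately show ?thesis
      using vector_derivative_unique_within_closed_interval [of 0 1 t] t by fastforce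
  qed
  \<comment> \<open>The velocity is orthogonal to \<open>\<gamma> t\<close>, so only the part of
    \<open>\<gamma> 0\<close> orthogonal to \<open>\<gamma> t\<close> is seen. Its squared length is
    \<open>1 - (c t)\<^sup>2\<close>, which improves plain Cauchy-Schwarz by the factor that
    \<open>arccos\<close> needs.\<close>
  have speed: "(\<gamma> 0 \<bullet> D t)\<^sup>2 \<le> (norm (D t))\<^sup>2 * (1 - (c t)\<^sup>2)" if t: "t \<in> {0..1}" for t
  proof -
    have "\<gamma> 0 \<bullet> D t = (\<gamma> 0 - c t *\<^sub>R \<gamma> t) \<bullet> D t"
      using orth [OF t] by (simp add: inner_diff_left)
    also have "\<bar>\<dots>\<bar> \<le> norm (\<gamma> 0 - c t *\<^sub>R \<gamma> t) * norm (D t)"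
      by (rule Cauchy_Schwarz_ineq2)
    finally have "(\<gamma> 0 \<bullet> D t)\<^sup>2 \<le> (norm (\<gamma> 0 - c t *\<^sub>R \<gamma> t))\<^sup>2 * (norm (D t))\<^sup>2"
      by (metis abs_ge_zero power2_abs power_mono power_mult_distrib)
    also have "(norm (\<gamma> 0 - c t *\<^sub>R \<gamma> t))\<^sup>2 = 1 - (c t)\<^sup>2"
      using n1 [of 0] n1 [OF t]
      unfolding power2_norm_eq_inner
      by (simp add: inner_diff_left inner_diff_right norm_eq_1 c_def
          inner_commute [of "\<gamma> t" "\<gamma> 0"] power2_eq_square)
    finally show ?thesis by (simp add: mult.commute)
  qed
  have intD: "(\<lambda>t. norm (D t)) integrable_on {0..1}"
    using cD by (intro integrable_continuous_interval continuous_intros)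
  \<comment> \<open>The factor \<open>k < 1\<close> keeps the argument of \<open>arccos\<close> away from \<open>\<plusminus>1\<close>, where it is not differentiable.\<close>
  have len_ge: "arccos (k * c 1) - arccos k \<le> len" if k: "0 < k" "k < 1" for k
  proof -
    have kc: "\<bar>k * c t\<bar> < 1" if "t \<in> {0..1}" for t
      using c1 [OF that] k by (simp add: abs_mult) (smt (verit) mult_left_le)
    define h where "h t = - (k * (\<gamma> 0 \<bullet> D t) / sqrt (1 - (k * c t)\<^sup>2))" for t
    have "((\<lambda>t. arccos (k * c t)) has_vector_derivative h t) (at t within {0..1})" if t: "t \<in> {0..1}" for t
    proof -
      have "(c has_derivative (\<lambda>h. \<gamma> 0 \<bullet> (h *\<^sub>R D t))) (at t within {0..1})"
        unfolding c_def using \<gamma>D [OF t] by (auto intro!: derivative_eq_intros)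
      then have "(c has_real_derivative (\<gamma> 0 \<bullet> D t)) (at t within {0..1})"
        by (simp add: has_field_derivative_def mult.commute [of _ "\<gamma> 0 \<bullet> D t"])
      then have "((\<lambda>t. arccos (k * c t)) has_real_derivative h t) (at t within {0..1})"
        using kc [OF t] unfolding h_def
        by (auto intro!: derivative_eq_intros simp: abs_less_iff field_simps)
      then show ?thesis by (simp add: has_real_derivative_iff_has_vector_derivative)
    qed
    then have "(h has_integral (arccos (k * c 1) - arccos (k * c 0))) {0..1}"
      by (intro fundamental_theorem_of_calculus) auto
    \<comment> \<open>The modified angle starts at \<open>arccos k\<close> instead of 0; this excess
      tends to 0 as \<open>k\<close> tends to 1.\<close>
    moreover have "c 0 = 1" using n1 [of 0] by (simp add: c_def norm_eq_1)
    moreover have "h t \<le> norm (D t)" if t: "t \<in> {0..1}" for t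
    proof -
      have pos: "1 - (k * c t)\<^sup>2 > 0" using kc [OF t] by (simp add: abs_square_less_1)
      have "(k * (\<gamma> 0 \<bullet> D t))\<^sup>2 \<le> (norm (D t))\<^sup>2 * (k\<^sup>2 * (1 - (c t)\<^sup>2))"
        using mult_left_mono [OF speed [OF t], of "k\<^sup>2"] by (simp add: power_mult_distrib algebra_simps)
      also have "\<dots> \<le> (norm (D t))\<^sup>2 * (1 - (k * c t)\<^sup>2)"
        using k by (intro mult_left_mono) (auto simp: power_mult_distrib algebra_simps power_le_one)
      finally have "(k * (\<gamma> 0 \<bullet> D t))\<^sup>2 \<le> (norm (D t) * sqrt (1 - (k * c t)\<^sup>2))\<^sup>2"
        using pos by (simp add: power_mult_distrib)
      then have "\<bar>k * (\<gamma> 0 \<bullet> D t)\<bar> \<le> norm (D t) * sqrt (1 - (k * c t)\<^sup>2)"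
        using pos by (simp add: abs_le_square_iff [symmetric] abs_mult)
      then show ?thesis using pos by (simp add: h_def field_simps)
    qed
    ultimately show ?thesis
      using has_integral_le [of h _ "{0..1}" "\<lambda>t. norm (D t)" len] intD
      by (simp add: len_def integrable_integral)
  qed
  \<comment> \<open>Continuity of \<open>arccos\<close> up to the ends of [-1, 1] lets the estimate
    pass to the limit, even for antipodal endpoints.\<close>
  have "((\<lambda>k. arccos (k * c 1) - arccos k) \<longlongrightarrow> arccos (1 * c 1) - arccos 1) (at 1 within {0..1})"
  proof -
    have "- 1 \<le> k * c 1 \<and> k * c 1 \<le> 1" if "k \<in> {0..1}" for k
    proof -
      have "\<bar>k * c 1\<bar> \<le> 1" using c1 [of 1] that by (simp add: abs_mult mult_le_one)
      then show ?thesis by linarith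
    qed
    then have "continuous_on {0..1} (\<lambda>k. arccos (k * c 1) - arccos k)"
      by (intro continuous_intros) auto
    then show ?thesis unfolding continuous_on_def by (rule bspec) simp
  qed
  moreover have "\<forall>\<^sub>F k in at 1 within {0..1}. arccos (k * c 1) - arccos k \<le> len"
  proof -
    have "\<forall>\<^sub>F k in at 1 within {0..1}. k \<in> {0<..} - {1::real} \<and> k \<in> {0..1}"
      by (auto simp: eventually_at_filter
          intro!: eventually_mono [OF eventually_nhds_in_open [of "{0<..}" "1::real"]])
    then show ?thesis by eventually_elim (auto intro!: len_ge)
  qed
  moreover have "at (1::real) within {0..1} \<noteq> bot"
    by (simp add: trivial_limit_within islimpt_Icc)
  ultimately have "arccos (1 * c 1) - arccos 1 \<le> len"
    by (intro tendsto_upperbound)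
  moreover have "len = integral {0..1} (\<lambda>t. norm (vector_derivative \<gamma> (at t)))"
    unfolding len_def by (intro integral_cong) (use D vector_derivative_at in metis)
  ultimately show ?thesis by (simp add: c_def)
qed

text \<open>Supplies the initial direction \<open>e\<close> of a great circle from \<open>a\<close>
  to \<open>b\<close>, including the cases \<open>b = a\<close> and \<open>b = - a\<close>.\<close>

lemma ex_orthonormal_in_plane:
  fixes a b :: "'a::euclidean_space"
  assumes "2 \<le> DIM('a)" "norm a = 1" "norm b = 1"
  obtains e where "norm e = 1" "a \<bullet> e = 0" "b = (a \<bullet> b) *\<^sub>R a + sqrt (1 - (a \<bullet> b)\<^sup>2) *\<^sub>R e"
proof -
  define d where "d = b - (a \<bullet> b) *\<^sub>R a"
  have aa: "a \<bullet> a = 1" "b \<bullet> b = 1" using assms by (auto simp: norm_eq_1)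
  have ad: "a \<bullet> d = 0" by (simp add: d_def inner_diff_right aa)
  have "d \<bullet> d = 1 - (a \<bullet> b)\<^sup>2"
    by (simp add: d_def inner_diff_right inner_diff_left aa inner_commute [of b a] power2_eq_square)
  then have nd: "norm d = sqrt (1 - (a \<bullet> b)\<^sup>2)" by (simp add: norm_eq_sqrt_inner)
  show thesis
  proof (cases "d = 0")
    case True
    \<comment> \<open>Here \<open>b\<close> is a multiple of \<open>a\<close> and determines no
      direction; any unit vector orthogonal to \<open>a\<close> serves, and dimension at least 2
      provides one.\<close>
    obtain y where "y \<noteq> 0" "orthogonal a y" using orthogonal_to_vector_exists [OF assms(1)] .
    moreover have "b = (a \<bullet> b) *\<^sub>R a" "sqrt (1 - (a \<bullet> b)\<^sup>2) = 0"
      using True nd by (auto simp: d_def)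
    ultimately show thesis
      by (intro that [of "sgn y"]) (auto simp: norm_sgn sgn_div_norm orthogonal_def)
  next
    case False
    then have "b = (a \<bullet> b) *\<^sub>R a + sqrt (1 - (a \<bullet> b)\<^sup>2) *\<^sub>R sgn d"
      unfolding nd [symmetric] by (simp add: sgn_div_norm d_def)
    then show thesis
      using False ad by (intro that [of "sgn d"]) (auto simp: norm_sgn sgn_div_norm)
  qed
qed

text \<open>A great-circle arc has constant speed equal to the angle, so it attains the lower bound
  for path lengths and the infimum is a minimum.\<close>

lemma sphere_dist_eq_arccos:
  fixes a b :: "'a::euclidean_space"
  assumes "2 \<le> DIM('a)" "norm a = 1" "norm b = 1"
  shows "sphere_dist a b = arccos (a \<bullet> b)"
proof -
  obtain e where e: "norm e = 1" "a \<bullet> e = 0" "b = (a \<bullet> b) *\<^sub>R a + sqrt (1 - (a \<bullet> b)\<^sup>2) *\<^sub>R e"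
    using ex_orthonormal_in_plane [OF assms] .
  define \<theta> where "\<theta> = arccos (a \<bullet> b)"
  have ab: "\<bar>a \<bullet> b\<bar> \<le> 1" using Cauchy_Schwarz_ineq2 [of a b] assms by simp
  have \<theta>: "\<theta> \<ge> 0" "cos \<theta> = a \<bullet> b" "sin \<theta> = sqrt (1 - (a \<bullet> b)\<^sup>2)"
    using ab by (auto simp: \<theta>_def arccos_lbound sin_arccos_abs cos_arccos_abs abs_le_iff)
  have nrm: "norm (x *\<^sub>R a + y *\<^sub>R e) = sqrt (x\<^sup>2 + y\<^sup>2)" for x y
    using e(1,2) assms(2)
    by (simp add: norm_eq_sqrt_inner inner_add_left inner_add_right inner_commute [of e a]
        power2_eq_square)
  define \<gamma> where "\<gamma> t = cos (\<theta> * t) *\<^sub>R a + sin (\<theta> * t) *\<^sub>R e" for t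
  define D where "D t = (- sin (\<theta> * t) * \<theta>) *\<^sub>R a + (cos (\<theta> * t) * \<theta>) *\<^sub>R e" for t
  have \<gamma>D: "(\<gamma> has_vector_derivative D t) (at t)" for t
    unfolding \<gamma>_def D_def has_vector_derivative_def
    by (auto intro!: derivative_eq_intros simp: algebra_simps)
  have nD: "norm (D t) = \<theta>" for t
  proof -
    have "(- sin (\<theta> * t) * \<theta>)\<^sup>2 + (cos (\<theta> * t) * \<theta>)\<^sup>2 = \<theta>\<^sup>2"
      by (simp add: power_mult_distrib distrib_right [symmetric])
    then show ?thesis using \<theta>(1) unfolding D_def nrm by simp
  qed
  show ?thesis
    unfolding sphere_dist_def \<theta>_def [symmetric]
  proof (rule cInf_eq_minimum)
    have "\<gamma> C1_differentiable_on {0..1}"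
      unfolding C1_differentiable_on_def using \<gamma>D
      by (intro exI [of _ D]) (auto simp: D_def intro!: continuous_intros)
    moreover have "\<gamma> ` {0..1} \<subseteq> sphere 0 1" by (auto simp: \<gamma>_def nrm)
    moreover have "\<gamma> 0 = a" "\<gamma> 1 = b" using e(3) \<theta> by (auto simp: \<gamma>_def)
    moreover have "\<theta> = integral {0..1} (\<lambda>t. norm (vector_derivative \<gamma> (at t)))"
      by (simp add: vector_derivative_at [OF \<gamma>D] nD)
    ultimately show "\<theta> \<in> {integral {0..1} (\<lambda>t. norm (vector_derivative \<gamma> (at t))) |\<gamma>.
        \<gamma> C1_differentiable_on {0..1} \<and> \<gamma> ` {0..1} \<subseteq> sphere 0 1 \<and> \<gamma> 0 = a \<and> \<gamma> 1 = b}"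
      by blast
  next
    fix l assume "l \<in> {integral {0..1} (\<lambda>t. norm (vector_derivative \<gamma> (at t))) |\<gamma>.
        \<gamma> C1_differentiable_on {0..1} \<and> \<gamma> ` {0..1} \<subseteq> sphere 0 1 \<and> \<gamma> 0 = a \<and> \<gamma> 1 = b}"
    then show "\<theta> \<le> l" using C1_sphere_path_length_ge unfolding \<theta>_def by blast
  qed
qed

section \<open>Coordinates of the Hopf fibration\<close>

text \<open>The powers of \<open>u\<close> repeat with period four like those of the complex unit;
  \<open>cos_coeff\<close> and \<open>sin_coeff\<close> encode this pattern, so the exponential
  series splits into the cosine and sine series.\<close>

lemma exp_imaginary_unit:
  fixes u :: "'a::{real_normed_algebra_1,banach}"
  assumes "u * u = - 1"
  shows "exp (\<theta> *\<^sub>R u) = cos \<theta> *\<^sub>R 1 + sin \<theta> *\<^sub>R u"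
proof -
  have "(\<theta> *\<^sub>R u) ^ n /\<^sub>R fact n = (cos_coeff n * \<theta> ^ n) *\<^sub>R 1 + (sin_coeff n * \<theta> ^ n) *\<^sub>R u" for n
  proof -
    have "u ^ n = fact n *\<^sub>R (cos_coeff n *\<^sub>R 1 + sin_coeff n *\<^sub>R u)"
    proof (induction n)
      case (Suc n)
      have "u ^ Suc n = (fact n * cos_coeff n) *\<^sub>R u + (fact n * sin_coeff n) *\<^sub>R (u * u)"
        by (simp add: Suc algebra_simps)
      also have "\<dots> = (fact (Suc n) * sin_coeff (Suc n)) *\<^sub>R u + (fact (Suc n) * cos_coeff (Suc n)) *\<^sub>R 1"
        by (simp add: assms sin_coeff_Suc cos_coeff_Suc fact_Suc del: of_nat_Suc)
      finally show ?case by (simp add: scaleR_add_right add.commute)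
    qed simp
    moreover have *: "inverse (fact n) * (\<theta> ^ n * (fact n * x)) = x * \<theta> ^ n" for x :: real
      by (simp add: field_simps)
    ultimately show ?thesis by (simp add: scaleR_power scaleR_add_right *)
  qed
  moreover have "(\<lambda>n. (cos_coeff n * \<theta> ^ n) *\<^sub>R 1 + (sin_coeff n * \<theta> ^ n) *\<^sub>R u) sums
      (cos \<theta> *\<^sub>R 1 + sin \<theta> *\<^sub>R u)"
    using sin_converges [of \<theta>] cos_converges [of \<theta>]
    by (intro sums_add) (auto intro: bounded_linear.sums [OF bounded_linear_scaleR_left])
  ultimately show ?thesis by (simp add: exp_def sums_unique [symmetric])
qed

lemma DIM_quat: "DIM(quat) = 4"
  by (simp add: Basis_quat_def)

lemma quat_inner_one: "(1::quat) \<bullet> x = qRe x"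
  by (simp add: inner_quat_def one_quat_def)

text \<open>The quaternion norm is multiplicative. At \<open>snd q = 0\<close> both sides are 0
  because division by zero gives 0, so the formula can be used globally.\<close>

lemma hopf_rho_eq: "hopf_rho q = norm (fst q) / norm (snd q)"
  by (simp add: hopf_rho_def norm_vec_def L2_set_def divide_quat_def norm_mult norm_inverse
      power_mult_distrib sum_distrib_right [symmetric] real_sqrt_mult divide_inverse)

lemma hopf_eta_eq:
  assumes "snd q \<noteq> 0"
  shows "hopf_eta q = arccos (qRe (snd q) / norm (snd q))"
  unfolding hopf_eta_def using assms
  by (subst sphere_dist_eq_arccos) (auto simp: DIM_quat quat_inner_one divide_inverse mult.commute)

text \<open>Valid also at \<open>snd q = 0\<close>, so it provides the homogeneity at every point
  that \<open>laplace_beltrami_homogeneous\<close> asks for.\<close>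

lemma hopf_psi_scaleR: "t > 0 \<Longrightarrow> hopf_psi (t *\<^sub>R q) = hopf_psi q"
  by (simp add: hopf_psi_def hopf_rho_eq hopf_eta_def field_simps)

section \<open>Gradients and Laplacians of the two coordinates\<close>

lemma has_gradient_laplacian_hopf_rho:
  fixes q :: "'n::finite quat_vec"
  assumes "fst q \<noteq> 0" "snd q \<noteq> 0"
  defines "x \<equiv> norm (fst q)" and "y \<equiv> norm (snd q)"
  shows "has_gradient_laplacian hopf_rho (fst q /\<^sub>R (x * y), - (x / y ^ 3) *\<^sub>R snd q)
    ((4 * real CARD('n) - 1) / (x * y) - x / y ^ 3) q"
proof -
  have n: "x > 0" "y > 0" using assms by auto
  show ?thesis
    using has_gradient_laplacian_mult [OF
        has_gradient_laplacian_fst [OF has_gradient_laplacian_norm [OF assms(1)]]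
        has_gradient_laplacian_snd [OF has_gradient_laplacian_inverse_norm [OF assms(2)]]]
    unfolding x_def [symmetric] y_def [symmetric] hopf_rho_eq [abs_def] DIM_quat DIM_cart
    using n by (simp add: divide_inverse mult_ac)
qed

lemma has_derivative_partials:
  fixes f :: "real \<times> real \<Rightarrow> real"
  assumes "f differentiable at z"
  shows "(f has_derivative (\<lambda>h. frechet_derivative f (at z) (1, 0) * fst h
    + frechet_derivative f (at z) (0, 1) * snd h)) (at z)"
proof -
  have D: "(f has_derivative frechet_derivative f (at z)) (at z)"
    using assms by (simp add: frechet_derivative_works)
  interpret bounded_linear "frechet_derivative f (at z)"
    using D by (rule has_derivative_bounded_linear)
  have "frechet_derivative f (at z) h
      = frechet_derivative f (at z) (1, 0) * fst h + frechet_derivative f (at z) (0, 1) * snd h" for h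
  proof -
    have "h = fst h *\<^sub>R (1, 0) + snd h *\<^sub>R (0, 1)" by (simp add: prod_eq_iff)
    then have "frechet_derivative f (at z) h
        = frechet_derivative f (at z) (fst h *\<^sub>R (1, 0) + snd h *\<^sub>R (0, 1))"
      by simp
    then show ?thesis by (simp only: add scaleR) (simp add: mult.commute)
  qed
  then show ?thesis using D by (metis (no_types, lifting) ext)
qed

text \<open>Produces the data consumed by the two-variable chain rule. The mixed entries
  \<open>b\<close> and \<open>c\<close> are not identified, since they will only multiply inner
  products that vanish.\<close>

lemma smooth_second_order:
  fixes g :: "real \<times> real \<Rightarrow> real" and z :: "real \<times> real"
  assumes "smooth g"
  obtains g1 g2 a b c d where
    "\<And>z. (g has_derivative (\<lambda>h. g1 z * fst h + g2 z * snd h)) (at z)"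
    "(g1 has_derivative (\<lambda>h. a * fst h + b * snd h)) (at z)"
    "(g2 has_derivative (\<lambda>h. c * fst h + d * snd h)) (at z)"
proof -
  have "Ck 2 g" using assms by (simp add: smooth_def)
  then have "\<And>z. g differentiable at z" "\<And>v z. (\<lambda>x. frechet_derivative g (at x) v) differentiable at z"
    by (auto simp: numeral_2_eq_2)
  then show thesis
    by (intro that [OF has_derivative_partials has_derivative_partials has_derivative_partials]) auto
qed

text \<open>\<eta> is the angle between \<open>snd q\<close> and 1 in dimension 4. Recording
  \<open>v \<bullet> snd q = 0\<close> is what yields orthogonality to the gradient of \<rho>, whose
  second block is a multiple of \<open>snd q\<close>.\<close>

lemma has_gradient_laplacian_hopf_eta:
  fixes q :: "'n::finite quat_vec" and c s :: real
  assumes q: "snd q \<noteq> 0" and c: "\<bar>qRe (snd q) / norm (snd q)\<bar> < 1"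
  defines "c \<equiv> qRe (snd q) / norm (snd q)" and "s \<equiv> sqrt (1 - c\<^sup>2)"
  obtains v where "has_gradient_laplacian hopf_eta (0, v) (2 * c / (s * (norm (snd q))\<^sup>2)) q"
    and "v \<bullet> snd q = 0" and "v \<bullet> v = 1 / (norm (snd q))\<^sup>2"
proof -
  obtain v where v: "has_gradient_laplacian (\<lambda>x. arccos (qRe x / norm x)) v
      (2 * c / (s * (norm (snd q))\<^sup>2)) (snd q)"
    "v \<bullet> snd q = 0" "v \<bullet> v = 1 / (norm (snd q))\<^sup>2"
    using has_gradient_laplacian_angle [of "1::quat" "snd q"] assms
    by (auto simp: quat_inner_one DIM_quat)
  have "\<forall>\<^sub>F x in nhds q. snd x \<noteq> 0"
    using q by (intro eventually_nhds_in_open [of "{x. snd x \<noteq> 0}", simplified])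
      (auto intro!: open_Collect_neq continuous_intros)
  then have "\<forall>\<^sub>F x in nhds q. arccos (qRe (snd x) / norm (snd x)) = hopf_eta x"
    by eventually_elim (simp add: hopf_eta_eq)
  then have "has_gradient_laplacian hopf_eta (0, v) (2 * c / (s * (norm (snd q))\<^sup>2)) q"
    by (rule has_gradient_laplacian_cong [OF has_gradient_laplacian_snd [OF v(1)]])
  with v show thesis using that by blast
qed

section \<open>Derivatives along the fibres\<close>

text \<open>The flow is a one-parameter group, so the vertical derivative at the point reached at
  time \<theta> is the derivative at \<theta> along the orbit of \<open>q\<close>.\<close>

lemma vertical_deriv_twice:
  "vertical_deriv u (vertical_deriv u F) q = (deriv ^^ 2) (\<lambda>\<theta>. F (quat_act (exp (\<theta> *\<^sub>R u)) q)) 0"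
proof -
  have "vertical_deriv u F (quat_act (exp (\<theta> *\<^sub>R u)) q)
      = deriv (\<lambda>\<theta>. F (quat_act (exp (\<theta> *\<^sub>R u)) q)) \<theta>" for \<theta>
  proof -
    have "quat_act (exp (s *\<^sub>R u)) (quat_act (exp (\<theta> *\<^sub>R u)) q) = quat_act (exp ((\<theta> + s) *\<^sub>R u)) q" for s
    proof -
      have "exp (s *\<^sub>R u) * exp (\<theta> *\<^sub>R u) = exp ((\<theta> + s) *\<^sub>R u)"
        by (subst exp_add_commuting [symmetric]) (auto simp: algebra_simps)
      then show ?thesis by (simp add: quat_act_def mult.assoc [symmetric])
    qed
    then show ?thesis
      by (subst deriv_shift_0) (simp add: vertical_deriv_def o_def)
  qed
  then show ?thesis by (simp add: vertical_deriv_def [of u "vertical_deriv u F"] numeral_2_eq_2)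
qed

lemma quat_unit_exp:
  assumes "u \<in> {quatI, quatJ, quatK}"
  shows "norm (exp (\<theta> *\<^sub>R u)) = 1"
    and "qRe (exp (\<theta> *\<^sub>R u) * x) = cos \<theta> * qRe x + sin \<theta> * qRe (u * x)"
proof -
  have "u * u = - 1" using assms quat_units by auto
  then have e: "exp (\<theta> *\<^sub>R u) = cos \<theta> *\<^sub>R 1 + sin \<theta> *\<^sub>R u"
    by (rule exp_imaginary_unit)
  show "norm (exp (\<theta> *\<^sub>R u)) = 1"
    unfolding e norm_quat_def inner_quat_def
    using assms by (auto simp: quatI_def quatJ_def quatK_def one_quat_def power2_eq_square [symmetric])
  show "qRe (exp (\<theta> *\<^sub>R u) * x) = cos \<theta> * qRe x + sin \<theta> * qRe (u * x)"
    unfolding e by (simp add: distrib_right)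
qed

lemma hopf_rho_quat_act: "norm e = 1 \<Longrightarrow> hopf_rho (quat_act e q) = hopf_rho q"
  by (simp add: hopf_rho_eq quat_act_def norm_mult norm_vec_def)

lemma hopf_eta_quat_act_exp:
  assumes "u \<in> {quatI, quatJ, quatK}" "snd q \<noteq> 0"
  shows "hopf_eta (quat_act (exp (\<theta> *\<^sub>R u)) q)
    = arccos (qRe (snd q) / norm (snd q) * cos \<theta> + qRe (u * snd q) / norm (snd q) * sin \<theta>)"
proof -
  have "snd (quat_act (exp (\<theta> *\<^sub>R u)) q) \<noteq> 0" "norm (snd (quat_act (exp (\<theta> *\<^sub>R u)) q)) = norm (snd q)"
    using quat_unit_exp(1) [OF assms(1), of \<theta>] assms(2)
    by (auto simp: quat_act_def norm_mult)
  then show ?thesis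
    using quat_unit_exp(2) [OF assms(1), of \<theta>]
    by (simp add: hopf_eta_eq) (simp add: quat_act_def add_divide_distrib mult.commute)
qed

text \<open>Left multiplication by a unit moves one imaginary coordinate, up to sign, into the real
  part; the summands are the squared coordinates of \<open>x\<close>.\<close>

lemma quat_units_norm:
  "(qRe x)\<^sup>2 + (qRe (quatI * x))\<^sup>2 + (qRe (quatJ * x))\<^sup>2 + (qRe (quatK * x))\<^sup>2 = (norm x)\<^sup>2"
  unfolding power2_norm_eq_inner
  by (simp add: inner_quat_def quatI_def quatJ_def quatK_def times_quat_def
      power2_eq_square)

section \<open>Evaluation at a point of the sphere and comparison of coefficients\<close>

theorem proposition2p2:
  fixes f :: "real \<times> real \<Rightarrow> real" and q :: "'n::finite quat_vec" and r \<eta> :: real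
  assumes "f \<in> cyl_test_functions"
    and "q \<in> sphere 0 1" and "snd q \<noteq> 0"
    and "hopf_psi q = (tan r, \<eta>)"
    and "0 < r" and "r < pi / 2" and "0 < \<eta>" and "\<eta> < pi"
  shows "sub_laplacian (f \<circ> hopf_psi) q =
    cylindric_operator CARD('n) (\<lambda>r \<eta>. f (tan r, \<eta>)) r \<eta>"
proof -
  obtain g where g: "smooth g" and fg: "\<And>\<rho> \<eta>. \<rho> \<ge> 0 \<Longrightarrow> f (\<rho>, \<eta>) = g (\<rho>, \<eta>)"
    using assms(1) unfolding cyl_test_functions_def by blast
  obtain g1 g2 a b c d where
    \<Phi>: "\<And>z. (g has_derivative (\<lambda>h. g1 z * fst h + g2 z * snd h)) (at z)" and
    \<Phi>1: "(g1 has_derivative (\<lambda>h. a * fst h + b * snd h)) (at (tan r, \<eta>))" and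
    \<Phi>2: "(g2 has_derivative (\<lambda>h. c * fst h + d * snd h)) (at (tan r, \<eta>))"
    using smooth_second_order [OF g] by blast
  define \<alpha> \<beta> where "\<alpha> = g1 (tan r, \<eta>)" and "\<beta> = g2 (tan r, \<eta>)"
  \<comment> \<open>The domain type is left general: this serves the ambient space, the time
    parameter of the vertical flows, and the separate variables r and \<eta>.\<close>
  have chain: "has_gradient_laplacian (\<lambda>x. g (u x, w x)) (\<alpha> *\<^sub>R v1 + \<beta> *\<^sub>R v2)
      (a * (v1 \<bullet> v1) + (b + c) * (v1 \<bullet> v2) + d * (v2 \<bullet> v2) + \<alpha> * L1 + \<beta> * L2) p"
    if "has_gradient_laplacian u v1 L1 p" "has_gradient_laplacian w v2 L2 p" "u p = tan r" "w p = \<eta>"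
    for u w v1 v2 L1 L2 and p :: "'b::euclidean_space"
    using has_gradient_laplacian_compose2 [OF that(1,2), of g g1 g2 a b c d] that(3,4) \<Phi> \<Phi>1 \<Phi>2
    by (simp add: \<alpha>_def \<beta>_def)

  define x y S C where "x = norm (fst q)" and "y = norm (snd q)" and "S = sin r" and "C = cos r"
  have S: "S > 0" and C: "C > 0" and SC: "S\<^sup>2 = 1 - C\<^sup>2"
    using assms(5,6) by (auto simp: S_def C_def sin_gt_zero cos_gt_zero sin_squared_eq)
  have tan: "tan r = S / C" by (simp add: S_def C_def tan_def)
  have y0: "y > 0" using assms(3) by (simp add: y_def)
  have psi: "x / y = tan r" "hopf_eta q = \<eta>" and rho_q: "hopf_rho q = tan r"
    using assms(4) by (auto simp: hopf_psi_def hopf_rho_eq x_def y_def)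
  have xy: "x\<^sup>2 + y\<^sup>2 = 1"
    using assms(2) by (simp add: norm_prod_def x_def y_def)
  have x: "x = y * (S / C)" using psi(1) y0 by (simp add: tan field_simps)
  \<comment> \<open>The ratio tan r together with |x|^2 + |y|^2 = 1 forces |y| = cos r, and then |x|
    = sin r.\<close>
  have y: "y = C"
  proof -
    have "C\<^sup>2 = y\<^sup>2 * S\<^sup>2 + y\<^sup>2 * C\<^sup>2"
      using xy C unfolding x by (simp add: power_mult_distrib power_divide field_simps)
    then have "y\<^sup>2 = C\<^sup>2" by (simp add: SC algebra_simps)
    then show ?thesis using y0 C by (simp add: power2_eq_iff_nonneg)
  qed
  have x: "x = S" using x C y by simp
  have nz: "fst q \<noteq> 0" using x S by (auto simp: x_def)

  define k s where "k = qRe (snd q) / y" and "s = sin \<eta>"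
  have s: "s > 0" using assms(7,8) by (simp add: s_def sin_gt_zero)
  have "\<bar>qRe (snd q)\<bar> \<le> y"
    using Cauchy_Schwarz_ineq2 [of 1 "snd q"] by (simp add: quat_inner_one y_def)
  then have "\<bar>k\<bar> \<le> 1" using y0 by (simp add: k_def)
  moreover have arccos_k: "arccos k = \<eta>"
    using psi(2) assms(3) by (simp add: hopf_eta_eq k_def y_def)
  ultimately have k: "k = cos \<eta>" by (metis cos_arccos_abs)
  \<comment> \<open>The condition 0 < \<eta> < pi enters here, keeping \<open>arccos\<close> away
    from the ends of its domain.\<close>
  have k1: "\<bar>k\<bar> < 1"
    using s abs_square_less_1 [of k] by (simp add: k s_def cos_squared_eq)
  have sk: "s\<^sup>2 = 1 - k\<^sup>2" by (simp add: s_def k sin_squared_eq)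
  have s_eq: "sqrt (1 - k\<^sup>2) = s"
    unfolding sk [symmetric] using s by simp

  have lap: "laplace_beltrami (g \<circ> hopf_psi) q = a / C ^ 4 + d / C\<^sup>2
      + \<alpha> * ((4 * real CARD('n) - 1) / (S * C) - S / C ^ 3) + \<beta> * (2 * k / (s * C\<^sup>2))"
  proof -
    obtain v where v: "has_gradient_laplacian hopf_eta (0, v) (2 * k / (s * C\<^sup>2)) q"
        "v \<bullet> snd q = 0" "v \<bullet> v = 1 / C\<^sup>2"
      using has_gradient_laplacian_hopf_eta [OF assms(3)] k1
      unfolding y_def [symmetric] unfolding k_def [symmetric] s_eq unfolding y by blast
    have rho: "has_gradient_laplacian hopf_rho (fst q /\<^sub>R (S * C), - (S / C ^ 3) *\<^sub>R snd q)
        ((4 * real CARD('n) - 1) / (S * C) - S / C ^ 3) q"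
      using has_gradient_laplacian_hopf_rho [OF nz assms(3)]
      unfolding x_def [symmetric] y_def [symmetric] x y .
    have inner: "fst q \<bullet> fst q = S\<^sup>2" "snd q \<bullet> snd q = C\<^sup>2"
      using x y by (auto simp: x_def y_def power2_norm_eq_inner [symmetric])
    \<comment> \<open>The squared gradient of \<rho> is the square of sec^2 r, the derivative of tan
      r; equivalently, r has unit gradient on the unit sphere.\<close>
    have "(1 / (S * C))\<^sup>2 * S\<^sup>2 + (S / C ^ 3)\<^sup>2 * C\<^sup>2 = (C\<^sup>2 + S\<^sup>2) / C ^ 4"
      using S C by (simp add: field_simps eval_nat_numeral)
    also have "\<dots> = 1 / C ^ 4" by (simp add: SC)
    finally have vv: "(fst q /\<^sub>R (S * C), - (S / C ^ 3) *\<^sub>R snd q)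
        \<bullet> (fst q /\<^sub>R (S * C), - (S / C ^ 3) *\<^sub>R snd q) = 1 / C ^ 4"
      by (simp add: inner_prod_def inner power2_eq_square divide_inverse)
    \<comment> \<open>The \<open>(b + c)\<close> term is gone because \<open>v\<close> is orthogonal
      to \<open>snd q\<close>.\<close>
    have "has_gradient_laplacian (g \<circ> hopf_psi)
        (\<alpha> *\<^sub>R (fst q /\<^sub>R (S * C), - (S / C ^ 3) *\<^sub>R snd q) + \<beta> *\<^sub>R (0, v))
        (a / C ^ 4 + d / C\<^sup>2
          + \<alpha> * ((4 * real CARD('n) - 1) / (S * C) - S / C ^ 3) + \<beta> * (2 * k / (s * C\<^sup>2))) q"
      using chain [OF rho v(1)] psi v(2,3) vv
      by (simp add: hopf_psi_def o_def hopf_rho_eq x_def y_def inner_commute)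
    then show ?thesis
      by (rule laplace_beltrami_homogeneous) (use assms(2) in \<open>simp_all add: hopf_psi_scaleR\<close>)
  qed

  have vert: "vertical_deriv u (vertical_deriv u (g \<circ> hopf_psi)) q
      = d * ((qRe (u * snd q) / C)\<^sup>2 / s\<^sup>2)
        + \<beta> * (k / s - k / s ^ 3 * (qRe (u * snd q) / C)\<^sup>2)"
    if u: "u \<in> {quatI, quatJ, quatK}" for u
  proof -
    \<comment> \<open>Along the flow cos \<eta> is a sinusoid with value \<open>k\<close>, slope
      \<open>l\<close> and second derivative \<open>- k\<close> at time 0, while \<rho> has zero
      gradient; only \<open>d\<close> and \<beta> survive.\<close>
    define l where "l = qRe (u * snd q) / C"
    have "has_gradient_laplacian (\<lambda>\<theta>. k * cos \<theta> + l * sin \<theta>) (- k * sin 0 + l * cos 0) (- k) 0"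
      by (rule has_gradient_laplacian_real [of _ "\<lambda>\<theta>. - k * sin \<theta> + l * cos \<theta>"])
        (auto intro!: derivative_eq_intros always_eventually)
    then have "has_gradient_laplacian (\<lambda>\<theta>. k * cos \<theta> + l * sin \<theta>) l (- k) 0" by simp
    from has_gradient_laplacian_arccos [OF this]
    have "has_gradient_laplacian (\<lambda>\<theta>. arccos (k * cos \<theta> + l * sin \<theta>)) (- (l / s))
        (k / s - k / s ^ 3 * l\<^sup>2) 0"
      using k1 by (simp add: s_eq divide_inverse power2_eq_square [of l] mult_ac)
    from chain [OF has_gradient_laplacian_const this]
    have "has_gradient_laplacian (\<lambda>\<theta>. g (tan r, arccos (k * cos \<theta> + l * sin \<theta>))) (- \<beta> * (l / s))
        (d * (l\<^sup>2 / s\<^sup>2) + \<beta> * (k / s - k / s ^ 3 * l\<^sup>2)) 0"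
      by (simp add: arccos_k power2_eq_square)
    moreover have "(g \<circ> hopf_psi) (quat_act (exp (\<theta> *\<^sub>R u)) q)
        = g (tan r, arccos (k * cos \<theta> + l * sin \<theta>))" for \<theta>
      using hopf_eta_quat_act_exp [OF u assms(3)] y
      by (simp add: hopf_psi_def hopf_rho_quat_act [OF quat_unit_exp(1) [OF u]] rho_q
          k_def l_def y_def)
    ultimately show ?thesis
      unfolding vertical_deriv_twice l_def [symmetric]
      by (simp only: has_gradient_laplacian_deriv(2))
  qed
  have "k\<^sup>2 + (qRe (quatI * snd q) / C)\<^sup>2 + (qRe (quatJ * snd q) / C)\<^sup>2 + (qRe (quatK * snd q) / C)\<^sup>2 = 1"
    using quat_units_norm [of "snd q"] C
    unfolding k_def y_def [symmetric] unfolding y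
    by (simp add: power_divide add_divide_distrib [symmetric])
  then have units: "(qRe (quatI * snd q) / C)\<^sup>2 + (qRe (quatJ * snd q) / C)\<^sup>2 + (qRe (quatK * snd q) / C)\<^sup>2 = s\<^sup>2"
    unfolding sk by linarith
  have vert_sum: "vertical_deriv quatI (vertical_deriv quatI (g \<circ> hopf_psi)) q
      + vertical_deriv quatJ (vertical_deriv quatJ (g \<circ> hopf_psi)) q
      + vertical_deriv quatK (vertical_deriv quatK (g \<circ> hopf_psi)) q = d + \<beta> * (2 * k / s)"
  proof -
    have "d * (i / s\<^sup>2) + \<beta> * (k / s - k / s ^ 3 * i) + (d * (j / s\<^sup>2) + \<beta> * (k / s - k / s ^ 3 * j))
        + (d * (m / s\<^sup>2) + \<beta> * (k / s - k / s ^ 3 * m))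
      = d * ((i + j + m) / s\<^sup>2) + \<beta> * (3 * k / s - k / s ^ 3 * (i + j + m))" for i j m
      by (simp add: algebra_simps add_divide_distrib)
    \<comment> \<open>The three flows contribute \<open>3 * k / s\<close>, and the squared slopes,
      which add up to \<open>s\<^sup>2\<close>, take one \<open>k / s\<close> away; hence the 2 in
      front of the cotangent.\<close>
    moreover have "k / s ^ 3 * s\<^sup>2 = k / s" using s by (simp add: power2_eq_square power3_eq_cube)
    ultimately show ?thesis
      using s by (simp add: vert units)
  qed

  \<comment> \<open>\<rho> is nonnegative at every point, so the two compositions are equal as
    functions and all derivatives may be taken of \<open>g\<close>.\<close>
  have fg_psi: "f \<circ> hopf_psi = g \<circ> hopf_psi"
    by (simp add: fun_eq_iff hopf_psi_def hopf_rho_eq fg)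
  have "sub_laplacian (f \<circ> hopf_psi) q = a / C ^ 4 + d / C\<^sup>2
      + \<alpha> * ((4 * real CARD('n) - 1) / (S * C) - S / C ^ 3) + \<beta> * (2 * k / (s * C\<^sup>2))
      - (d + \<beta> * (2 * k / s))"
    unfolding sub_laplacian_def fg_psi lap vert_sum [symmetric] by simp
  also have "\<dots> = a / C ^ 4 + \<alpha> * (2 * S / C ^ 3)
      + ((4 * real CARD('n) - 1) * (C / S) - 3 * (S / C)) * (\<alpha> / C\<^sup>2)
      + (S / C)\<^sup>2 * (d + 2 * (k / s) * \<beta>)"
  proof -
    have 1: "(S / C)\<^sup>2 = 1 / C\<^sup>2 - 1" using C by (simp add: power_divide SC field_simps)
    \<comment> \<open>\<open>2 * S / C ^ 3\<close> is the second derivative of the tangent. It is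
      split off to complete the second derivative in r, which turns the coefficient -1 of
      \<open>S / C ^ 3\<close> into -3.\<close>
    have 2: "(4 * real CARD('n) - 1) / (S * C) - S / C ^ 3
        = 2 * S / C ^ 3 + ((4 * real CARD('n) - 1) * (C / S) - 3 * (S / C)) / C\<^sup>2"
      using S C by (simp add: field_simps eval_nat_numeral)
    show ?thesis unfolding 1 2 using s C by (simp add: field_simps)
  qed
  also have "\<dots> = cylindric_operator CARD('n) (\<lambda>r \<eta>. f (tan r, \<eta>)) r \<eta>"
  proof -
    have ev: "\<forall>\<^sub>F t in nhds r. t \<in> {0 <..< pi / 2}"
      using assms(5,6) by (intro eventually_nhds_in_open) auto
    then have "\<forall>\<^sub>F t in nhds r. (tan has_real_derivative inverse ((cos t)\<^sup>2)) (at t)"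
      by eventually_elim (auto intro!: DERIV_tan dest: cos_gt_zero)
    moreover have "((\<lambda>t. inverse ((cos t)\<^sup>2)) has_real_derivative 2 * S / C ^ 3) (at r)"
      using C by (auto intro!: derivative_eq_intros simp: S_def C_def field_simps eval_nat_numeral)
    ultimately have "has_gradient_laplacian tan (inverse ((cos r)\<^sup>2)) (2 * S / C ^ 3) r"
      by (rule has_gradient_laplacian_real)
    then have "has_gradient_laplacian tan (1 / C\<^sup>2) (2 * S / C ^ 3) r"
      by (simp add: C_def divide_inverse)
    from chain [OF this has_gradient_laplacian_const]
    have "has_gradient_laplacian (\<lambda>t. g (tan t, \<eta>)) (\<alpha> / C\<^sup>2) (a / C ^ 4 + \<alpha> * (2 * S / C ^ 3)) r"
      by (simp add: power4_eq_xxxx power2_eq_square mult.assoc)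
    \<comment> \<open>Near \<open>r\<close> the tangent stays positive, so the target operator,
      stated for \<open>f\<close>, can be evaluated through \<open>g\<close>.\<close>
    moreover have "\<forall>\<^sub>F t in nhds r. g (tan t, \<eta>) = f (tan t, \<eta>)"
      using ev by eventually_elim (auto simp: fg tan_gt_zero less_imp_le)
    ultimately have R: "has_gradient_laplacian (\<lambda>t. f (tan t, \<eta>)) (\<alpha> / C\<^sup>2)
        (a / C ^ 4 + \<alpha> * (2 * S / C ^ 3)) r"
      by (rule has_gradient_laplacian_cong)
    have "has_gradient_laplacian (\<lambda>t. t) 1 0 \<eta>"
      using has_gradient_laplacian_inner [of "1::real" \<eta>] by simp
    from chain [OF has_gradient_laplacian_const this]
    have "has_gradient_laplacian (\<lambda>t. g (tan r, t)) \<beta> d \<eta>" by simp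
    then have E: "has_gradient_laplacian (\<lambda>t. f (tan r, t)) \<beta> d \<eta>"
      using S C by (simp add: fg tan)
    show ?thesis
      unfolding cylindric_operator_def has_gradient_laplacian_deriv [OF R]
        has_gradient_laplacian_deriv [OF E]
      by (simp add: tan cot_def k s_def S_def [symmetric] C_def [symmetric])
  qed
  finally show ?thesis .
qed

end
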